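(* For $n\ge 2$, the supercentralizer $SZ(\mathfrak A_n,\mathfrak A_{n-1})$ is generated by the supercenter $SZ(\mathfrak A_{n-1})$ and the element $\pi_n$. Consequently, for the chain $\mathfrak Y=(\mathbb C=\mathfrak A_1\subset\mathfrak A_2\subset\dots\subset\mathfrak A_n)$, the Gelfand–Tsetlin superalgebra $SGZ(\mathfrak Y)$ equals $\mathbb C[\pi_1,\dots,\pi_n]$, and the algebra $SZ(\mathfrak Y)$ generated by the supercenters $SZ(\mathfrak A_1),\dots,SZ(\mathfrak A_n)$ equals $\mathbb C[\pi_1^2,\dots,\pi_n^2]$.
   Context: $\mathfrak A_n$ is the $\mathbb Z_2$-graded $\mathbb C$-algebra generated by odd elements $\tau_1,\dots,\tau_{n-1}$ with relations $\tau_k^2=1$, $(\tau_k\tau_{k+1})^3=1$, $(\tau_k\tau_l)^2=-1$ for $|k-l|>1$; $\mathfrak A_{n-1}\subset\mathfrak A_n$ via $\tau_k\mapsto\tau_k$, and $\mathfrak A_1=\mathbb C$. Set $\tau_{i,i+1}=\tau_i$, $\tau_{ij}=-\tau_{i,j-1}\tau_{j-1}\tau_{i,j-1}$ for $i<j-1$, $\tau_{ji}=-\tau_{ij}$. The odd Young–Jucys–Murphy elements are $\pi_k=\tau_{1k}+\tau_{2k}+\dots+\tau_{k-1,k}$ ($\pi_1=0$). Supercentralizer: $SZ(A,B)$ is the span of homogeneous $a\in A$ with $ab=(-1)^{p(a)p(b)}ba$ for all homogeneous $b\in B$; $SZ(A)=SZ(A,A)$. $SGZ(\mathfrak Y)$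 is the subalgebra generated by $SZ(\mathfrak A_{k+1},\mathfrak A_k)$, $k=1,\dots,n-1$. *)

theory Defs
  imports Complex_Main "HOL-Library.Poly_Mapping"
begin

text \<open>Words in the letters 1,2,3,... (letter k stands for the generator tau_k).
  Words form a (non-commutative) monoid under concatenation.\<close>

datatype wrd = Wd "nat list"

fun letters :: "wrd \<Rightarrow> nat list" where "letters (Wd xs) = xs"

instantiation wrd :: monoid_add
begin
definition zero_wrd :: wrd where "zero_wrd = Wd []"
fun plus_wrd :: "wrd \<Rightarrow> wrd \<Rightarrow> wrd" where "plus_wrd (Wd a) (Wd b) = Wd (a @ b)"
instance
proof
  fix a b c :: wrd
  show "a + b + c = a + (b + c)" by (cases a; cases b; cases c) auto
  show "0 + a = a" by (cases a) (auto simp: zero_wrd_def)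
  show "a + 0 = a" by (cases a) (auto simp: zero_wrd_def)
qed
end

text \<open>The free associative unital C-algebra on generators tau_1, tau_2, ...:
  finitely supported C-valued functions on words, with convolution product
  (monoid algebra of the free monoid).\<close>

type_synonym fa = "wrd \<Rightarrow>\<^sub>0 complex"

definition scal :: "complex \<Rightarrow> fa" where "scal c = Poly_Mapping.single 0 c"

definition gen :: "nat \<Rightarrow> fa" where "gen k = Poly_Mapping.single (Wd [k]) 1"

definition rels :: "nat \<Rightarrow> fa set" where
  "rels n =
     {gen k * gen k - 1 | k. 1 \<le> k \<and> k \<le> n - 1}
   \<union> {(gen k * gen (k+1)) ^ 3 - 1 | k. 1 \<le> k \<and> k + 1 \<le> n - 1}
   \<union> {(gen k * gen l) ^ 2 + 1 | k l. 1 \<le> k \<and> k \<le> n - 1 \<and> 1 \<le> l \<and> l \<le> n - 1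
                                  \<and> (k > l + 1 \<or> l > k + 1)}"

text \<open>Two-sided ideal of the free algebra generated by the relations of A_n,
  together with all generators tau_k with k outside 1..n-1 (so that the
  quotient is exactly the algebra generated by tau_1,...,tau_{n-1}).\<close>

inductive_set ideal_n :: "nat \<Rightarrow> fa set" for n :: nat where
  rel: "r \<in> rels n \<Longrightarrow> r \<in> ideal_n n"
| extra: "k = 0 \<or> k \<ge> n \<Longrightarrow> gen k \<in> ideal_n n"
| zero: "0 \<in> ideal_n n"
| add: "x \<in> ideal_n n \<Longrightarrow> y \<in> ideal_n n \<Longrightarrow> x + y \<in> ideal_n n"
| mult: "x \<in> ideal_n n \<Longrightarrow> a * x * b \<in> ideal_n n"

definition eqv :: "nat \<Rightarrow> fa \<Rightarrow> fa \<Rightarrow> bool" where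
  "eqv n x y \<longleftrightarrow> x - y \<in> ideal_n n"

text \<open>Z_2-grading: the parity of a word is its length mod 2 (the generators are odd).
  An element of A_n is homogeneous of parity p if it has a representative all of
  whose words have length of parity p.\<close>

definition homog :: "nat \<Rightarrow> nat \<Rightarrow> fa \<Rightarrow> bool" where
  "homog n p x \<longleftrightarrow> p < 2 \<and>
     (\<exists>y. eqv n x y \<and> (\<forall>w \<in> Poly_Mapping.keys y. length (letters w) mod 2 = p))"

text \<open>The subalgebra A_k of A_n (k \<le> n), i.e. the image of A_k under the
  embedding tau_j \<mapsto> tau_j: elements with a representative involving only
  the letters 1..k-1.\<close>

definition subalg :: "nat \<Rightarrow> nat \<Rightarrow> fa set" where
  "subalg n k = {x. \<exists>y. eqv n x y \<and>
     (\<forall>w \<in> Poly_Mapping.keys y. \<forall>j \<in> set (letters w). 1 \<le> j \<and> j < k)}"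

inductive_set qspan :: "nat \<Rightarrow> fa set \<Rightarrow> fa set" for n :: nat and S :: "fa set" where
  base: "x \<in> S \<Longrightarrow> x \<in> qspan n S"
| zero: "0 \<in> qspan n S"
| add: "x \<in> qspan n S \<Longrightarrow> y \<in> qspan n S \<Longrightarrow> x + y \<in> qspan n S"
| smult: "x \<in> qspan n S \<Longrightarrow> scal c * x \<in> qspan n S"
| eq: "x \<in> qspan n S \<Longrightarrow> eqv n x y \<Longrightarrow> y \<in> qspan n S"

inductive_set qgen :: "nat \<Rightarrow> fa set \<Rightarrow> fa set" for n :: nat and S :: "fa set" where
  base: "x \<in> S \<Longrightarrow> x \<in> qgen n S"
| one: "1 \<in> qgen n S"
| add: "x \<in> qgen n S \<Longrightarrow> y \<in> qgen n S \<Longrightarrow> x + y \<in> qgen n S"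
| smult: "x \<in> qgen n S \<Longrightarrow> scal c * x \<in> qgen n S"
| mult: "x \<in> qgen n S \<Longrightarrow> y \<in> qgen n S \<Longrightarrow> x * y \<in> qgen n S"
| eq: "x \<in> qgen n S \<Longrightarrow> eqv n x y \<Longrightarrow> y \<in> qgen n S"

definition SZ :: "nat \<Rightarrow> nat \<Rightarrow> nat \<Rightarrow> fa set" where
  "SZ n k m = qspan n {a. a \<in> subalg n k \<and>
      (\<exists>p. homog n p a \<and>
        (\<forall>b q. b \<in> subalg n m \<and> homog n q b \<longrightarrow>
               eqv n (a * b) ((-1) ^ (p * q) * (b * a))))}"

primrec tauij :: "nat \<Rightarrow> nat \<Rightarrow> fa" where
  "tauij i 0 = 0"
| "tauij i (Suc j) = (if j = i then gen i
                      else if i < j then - (tauij i j * gen j * tauij i j) else 0)"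

definition pi_el :: "nat \<Rightarrow> fa" where
  "pi_el k = (\<Sum>i\<in>{1..<k}. tauij i k)"

end

(* Signed conjugation T_(ab) x = sg (t_ab x t_ab), where sg is the parity automorphism, is an
   algebra automorphism that sends t_ij to t_(s i)(s j) for s = (a b), without any sign.  So S_m acts on
   A_n, and SZ(A_k, A_m) is exactly the space of S_m-invariants of A_k.

   With A = A_(m+1) and invariants under S_m, every word in the t_ij is, up to sign, a product
   t_(i_1,m+1) ... t_(i_k,m+1) u with distinct i_j outside the support of u.  Averaging it over S_m gives,
   up to a nonzero factor, pi_(m+1)^k times the average of u (which lies in SZ(A_m)), modulo averages of
   words of smaller support.  Induction on the support proves the first claim; no basis of A_n is needed.

   The supercenters have no odd part: an odd word t x averages to the negative of x t, and rotating
   through all of its letters shows that its average vanishes.  Hence SZ(A_k) lies in C[pi_1^2,...,pi_k^2].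
   Conversely, pi_1^2 + ... + pi_k^2 is supercentral in A_k. *)
theory Submission
  imports Defs "HOL-Combinatorics.Transposition"
begin

text \<open>Conjugating by t_ab gives - t_(s i)(s j); each t_ij is odd, so the parity automorphism
  cancels this sign. On a homogeneous element the same automorphism supplies exactly the sign of
  supercommutation, which is why both parities of the supercentralizer become invariants of one
  action. Two facts drive the averaging argument. Averaging is linear over the invariants, so
  multiplication by pi_(m+1) passes through it. And S_m is transitive on tuples of distinct indices
  avoiding the support of u, so all main terms of pi_(m+1)^k u have the same average, whose nonzero
  multiplicity can be divided out over C. Squares enter because pi_(m+1) is odd and S_m-invariant,
  hence commutes with the earlier squares: an element of SZ(A_(m+1)) takes the form p + pi_(m+1) q
  with p, q polynomials in squares, and the odd summand must vanish. For the converse, signed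
  conjugation by t_(m,m+1) takes pi_m to pi_(m+1) - t_(m,m+1), and expanding the square shows that
  pi_m^2 + pi_(m+1)^2 is fixed.\<close>

lemma transpose_inj_iff: "transpose a b i = transpose a b j \<longleftrightarrow> i = j"
  by (metis transpose_involutory)

lemma transpose_in: "a \<in> S \<Longrightarrow> b \<in> S \<Longrightarrow> i \<in> S \<Longrightarrow> transpose a b i \<in> S"
  by (auto simp: transpose_def)

section \<open>Spin symmetric group algebras inside a ring\<close>

text \<open>The unit \<open>e\<close> of the algebra need not be the unit of the ambient ring: the algebras \<open>A_n\<close> for
  all \<open>n\<close> are later realised as corners of one ring. The assumptions are stated for the whole ring, so
  that \<open>e\<close> is central; elements outside the corner are projected into it by \<open>T\<close>.\<close>

locale spin_tower =
  fixes n :: nat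
    and e :: "'a::ring"
    and sc :: "complex \<Rightarrow> 'a"
    and sg :: "'a \<Rightarrow> 'a"
    and g :: "nat \<Rightarrow> 'a"
  assumes sc_add: "sc (c + d) = sc c + sc d"
    and sc_mult: "sc (c * d) = sc c * sc d"
    and sc_1: "sc 1 = e"
    and sc_commute: "x * sc c = sc c * x"
    and sg_add: "sg (x + y) = sg x + sg y"
    and sg_mult: "sg (x * y) = sg x * sg y"
    and sg_sg: "sg (sg x) = x"
    and sg_sc: "sg (sc c) = sc c"
    and sg_g: "sg (g k) = - g k"
    and e_g: "e * g k = g k"
    and g_sq: "1 \<le> k \<Longrightarrow> k < n \<Longrightarrow> g k * g k = e"
    and g_cube: "1 \<le> k \<Longrightarrow> Suc k < n \<Longrightarrow>
      g k * g (Suc k) * (g k * g (Suc k)) * (g k * g (Suc k)) = e"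
    and g_far: "1 \<le> k \<Longrightarrow> k < n \<Longrightarrow> 1 \<le> l \<Longrightarrow> l < n \<Longrightarrow> k > l + 1 \<or> l > k + 1 \<Longrightarrow>
      g k * g l * (g k * g l) = - e"
begin

lemma e_commute: "x * e = e * x"
  using sc_commute[of x 1] by (simp add: sc_1)

lemma e_e: "e * e = e"
  using sc_mult[of 1 1] by (simp add: sc_1)

lemma e_left: "e * (e * x) = e * x"
  by (metis e_e mult.assoc)

lemma g_e: "g k * e = g k"
  by (simp add: e_commute e_g)

lemma sg_0: "sg 0 = 0"
  using sg_add[of 0 0] by simp

lemma sg_minus: "sg (- x) = - sg x"
  using sg_add[of x "- x"] by (simp add: sg_0 eq_neg_iff_add_eq_0 add.commute)

lemma sg_e: "sg e = e"
  using sg_sc[of 1] by (simp add: sc_1)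

lemma e_g_left: "e * (g k * x) = g k * x"
  by (simp add: e_g flip: mult.assoc)

lemma g_sq_left: "1 \<le> k \<Longrightarrow> k < n \<Longrightarrow> g k * (g k * x) = e * x"
  by (simp add: g_sq flip: mult.assoc)

lemma g_anticommute:
  assumes "1 \<le> k" "k < n" "1 \<le> l" "l < n" "k > l + 1 \<or> l > k + 1"
  shows "g k * g l = - (g l * g k)"
proof -
  have "g k * (g k * g l * (g k * g l)) * g l = g l * g k"
    using assms by (simp add: mult.assoc g_sq_left g_sq g_e e_g_left)
  then show ?thesis
    unfolding g_far[OF assms] by (simp add: g_e mult.assoc e_g) (metis minus_minus)
qed

lemma g_braid:
  assumes "1 \<le> k" "Suc k < n"
  shows "g k * g (Suc k) * g k = g (Suc k) * g k * g (Suc k)"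
proof -
  let ?a = "g k" and ?b = "g (Suc k)"
  have "?a * ?b * ?a = ?a * ?b * ?a * e"
    by (simp add: mult.assoc g_e)
  \<comment> \<open>Here \<open>e\<close> is written as \<open>(b a b)(b a b)\<close>, so that the
    first six factors form the cube of \<open>a b\<close>.\<close>
  also have "\<dots> = ?a * ?b * ?a * (?b * (?a * (?b * ?b) * ?a) * ?b)"
    using assms by (simp add: g_sq g_e)
  also have "\<dots> = (?a * ?b * (?a * ?b) * (?a * ?b)) * (?b * ?a * ?b)"
    by (simp add: mult.assoc)
  also have "\<dots> = ?b * ?a * ?b"
    unfolding g_cube[OF assms] by (simp add: e_g flip: mult.assoc)
  finally show ?thesis .
qed

section \<open>The transposition elements and conjugation by generators\<close>

primrec tt :: "nat \<Rightarrow> nat \<Rightarrow> 'a" where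
  "tt i 0 = 0"
| "tt i (Suc j) = (if j = i then g i
                   else if i < j then - (tt i j * g j * tt i j) else 0)"

lemma e_tt: "e * tt i j = tt i j"
  by (induction j) (auto simp: e_g simp flip: mult.assoc)

lemma sg_tt: "sg (tt i j) = - tt i j"
  by (induction j) (auto simp: sg_g sg_minus sg_mult sg_0)

text \<open>By its recursion \<open>tt i j\<close> is a word of odd length in \<open>g i\<close>,
  ..., \<open>g (j - 1)\<close>, each of which anticommutes with \<open>g k\<close>.\<close>

lemma tt_anticommute:
  assumes "1 \<le> i" "i < j" "j \<le> n" "1 \<le> k" "k < n" "k + 1 < i \<or> j < k"
  shows "g k * tt i j = - (tt i j * g k)"
  using assms(2,3,6)
proof (induction j)
  case (Suc j)
  show ?case
  proof (cases "j = i")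
    case True
    then show ?thesis using Suc.prems assms by (simp add: g_anticommute)
  next
    case False
    then have "i < j" using Suc.prems by simp
    have 1: "g k * tt i j = - (tt i j * g k)"
      using Suc \<open>i < j\<close> by auto
    have 2: "g k * g j = - (g j * g k)"
      using Suc.prems assms \<open>i < j\<close> by (intro g_anticommute) auto
    have "g k * (tt i j * g j * tt i j) = (g k * tt i j) * g j * tt i j" by (simp add: mult.assoc)
    also have "\<dots> = - (tt i j * (g k * g j) * tt i j)" unfolding 1 by (simp add: mult.assoc)
    also have "\<dots> = tt i j * g j * (g k * tt i j)" unfolding 2 by (simp add: mult.assoc)
    also have "\<dots> = - (tt i j * g j * tt i j * g k)" unfolding 1 by (simp add: mult.assoc)
    finally show ?thesis using \<open>i < j\<close> by simp
  qed
qed simp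

text \<open>The braid relation turns the recursion into conjugation by a single generator,
  \<open>tt i (Suc j) = - (g j * tt i j * g j)\<close>, on which all later computations rest. Its
  own inductive step combines the relation at \<open>j\<close>, the braid relation of the
  generators, and anticommutation of \<open>g (Suc j)\<close> with \<open>tt i j\<close>.\<close>

lemma tt_sq_braid:
  assumes "1 \<le> i" "i < j" "j \<le> n"
  shows "tt i j * tt i j = e \<and> (j < n \<longrightarrow> tt i j * g j * tt i j = g j * tt i j * g j)"
  using assms(2,3)
proof (induction j)
  case (Suc j)
  show ?case
  proof (cases "j = i")
    case True
    then show ?thesis using Suc.prems assms by (simp add: g_sq g_braid)
  next
    case False
    then have ij: "i < j" using Suc.prems by simp
    define a b c where "a = tt i j" and "b = g j" and "c = g (Suc j)"
    have aa: "a * a = e" and aba: "a * b * a = b * a * b" 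
      using Suc ij by (auto simp: a_def b_def)
    have bb: "b * b = e" using Suc.prems assms ij by (simp add: b_def g_sq)
    have ea: "e * a = a" "a * e = a" and eb: "e * b = b" "b * e = b" 
      by (simp_all add: a_def b_def e_tt e_g e_commute[of "tt _ _"] g_e)
    have "(a * b * a) * (a * b * a) = a * b * (a * a) * b * a"
      by (simp add: mult.assoc)
    also have "\<dots> = e" using aa bb ea eb by (metis mult.assoc)
    finally have sq: "(a * b * a) * (a * b * a) = e" .
    have "(a * b * a) * c * (a * b * a) = - (c * (a * b * a) * c)" if "Suc j < n"
    proof -
      have cc: "c * c = e" using that by (simp add: c_def g_sq)
      have ca: "c * a = - (a * c)"
        unfolding a_def c_def using Suc.prems assms ij that by (intro tt_anticommute) auto
      have bcb: "b * c * b = c * b * c"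
        unfolding b_def c_def using assms ij that by (intro g_braid) auto
      have ec: "e * c = c" by (simp add: c_def e_g)
      have "(a * b * a) * c * (a * b * a) = b * a * (b * c * b) * a * b"
        unfolding aba by (simp add: mult.assoc)
      also have "\<dots> = - (b * a * c * b * (a * c) * b)"
        unfolding bcb using ca by (simp add: mult.assoc)
      also have "\<dots> = b * (c * a) * b * (a * c) * b"
        unfolding ca by (simp add: mult.assoc)
      also have "\<dots> = b * c * (a * b * a) * c * b"
        by (simp add: mult.assoc)
      also have "\<dots> = (b * c * b) * a * (b * c * b)"
        unfolding aba by (simp add: mult.assoc)
      also have "\<dots> = c * b * (c * a) * c * b * c"
        unfolding bcb by (simp add: mult.assoc)
      also have "\<dots> = - (c * b * a * (c * c) * b * c)"
        unfolding ca by (simp add: mult.assoc)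
      also have "\<dots> = - (c * (b * a * b) * c)"
        unfolding cc by (simp add: mult.assoc eb)
      finally show ?thesis unfolding aba .
    qed
    then show ?thesis using sq ij by (simp add: a_def b_def c_def)
  qed
qed simp

definition t :: "nat \<Rightarrow> nat \<Rightarrow> 'a" where
  "t i j = (if i < j then tt i j else - tt j i)"

text \<open>For odd \<open>x\<close> this is the signed conjugation by \<open>g k\<close>: the minus
  sign stands for the parity automorphism, since \<open>g k * x * g k\<close> is again odd.\<close>

definition cj :: "nat \<Rightarrow> 'a \<Rightarrow> 'a" where "cj k x = - (g k * x * g k)"

lemma cj_cj: "1 \<le> k \<Longrightarrow> k < n \<Longrightarrow> cj k (cj k x) = e * x"
  by (simp add: cj_def mult.assoc g_sq_left g_sq g_e) (simp add: e_e e_commute[of x] flip: mult.assoc)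

lemma cj_commute:
  assumes "1 \<le> k" "k < n" "1 \<le> l" "l < n" "k > l + 1 \<or> l > k + 1"
  shows "cj k (cj l x) = cj l (cj k x)"
proof -
  have "cj k (cj l x) = (g k * g l) * x * (g l * g k)" by (simp add: cj_def mult.assoc)
  also have "\<dots> = (g l * g k) * x * (g k * g l)"
    using g_anticommute[OF assms] by simp
  finally show ?thesis by (simp add: cj_def mult.assoc)
qed

lemma cj_braid:
  assumes "1 \<le> k" "Suc k < n"
  shows "cj k (cj (Suc k) (cj k x)) = cj (Suc k) (cj k (cj (Suc k) x))"
proof -
  have "cj k (cj (Suc k) (cj k x)) = - ((g k * g (Suc k) * g k) * x * (g k * g (Suc k) * g k))"
    by (simp add: cj_def mult.assoc)
  then show ?thesis unfolding g_braid[OF assms] by (simp add: cj_def mult.assoc)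
qed

lemma cj_anticommute:
  assumes "1 \<le> k" "k < n" "g k * x = - (x * g k)" "e * x = x"
  shows "cj k x = x"
  using assms by (simp add: cj_def mult.assoc g_sq e_commute[of x])

lemma cj_minus: "cj k (- x) = - cj k x"
  by (simp add: cj_def)

lemma cj_tt_up:
  assumes "1 \<le> i" "i < j" "j < n"
  shows "cj j (tt i j) = tt i (Suc j)"
  using tt_sq_braid[of i j] assms by (simp add: cj_def)

lemma cj_tt_down:
  assumes "1 \<le> i" "i < j" "j < n"
  shows "cj j (tt i (Suc j)) = tt i j"
  using cj_tt_up[OF assms] cj_cj[of j "tt i j"] assms by (simp add: e_tt)

text \<open>The shortest case \<open>j = i + 2\<close> is the braid relation of the generators. For
  larger \<open>j\<close>, the last conjugation \<open>cj (j - 1)\<close> that builds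
  \<open>tt i j\<close> is far from \<open>cj i\<close> and commutes with it.\<close>

lemma cj_tt_left_up:
  assumes "1 \<le> i" "Suc i < j" "j \<le> n"
  shows "cj i (tt i j) = tt (Suc i) j"
  using assms(2,3)
proof (induction j)
  case (Suc j)
  show ?case
  proof (cases "j = Suc i")
    case True
    have "tt i (Suc j) = cj i (g (Suc i))"
      using True Suc.prems assms g_braid[of i] by (simp add: cj_def)
    then show ?thesis using True Suc.prems assms cj_cj[of i] by (simp add: e_g)
  next
    case False
    then have "tt i (Suc j) = cj j (tt i j)"
      using Suc.prems assms by (simp add: cj_tt_up del: tt.simps)
    moreover have "cj i (cj j (tt i j)) = cj j (cj i (tt i j))"
      using Suc.prems assms False by (intro cj_commute) auto
    moreover have "cj i (tt i j) = tt (Suc i) j"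
      using Suc False by auto
    ultimately show ?thesis
      using Suc.prems assms False by (simp add: cj_tt_up del: tt.simps)
  qed
qed simp

text \<open>In the shortest case \<open>tt i (k + 2)\<close> is
  \<open>cj (k + 1) (cj k (tt i k))\<close>; applying \<open>cj k\<close> and braiding leaves
  \<open>cj (k + 1)\<close> innermost, where it fixes \<open>tt i k\<close>.\<close>

lemma cj_tt_mid:
  assumes "1 \<le> i" "i < k" "Suc k < j" "j \<le> n"
  shows "cj k (tt i j) = tt i j"
  using assms(3,4)
proof (induction j)
  case (Suc j)
  show ?case
  proof (cases "j = Suc k")
    case True
    have 1: "tt i (Suc j) = cj (Suc k) (cj k (tt i k))"
      using True Suc.prems assms by (simp add: cj_tt_up del: tt.simps)
    have "cj k (tt i (Suc j)) = cj (Suc k) (cj k (cj (Suc k) (tt i k)))"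
      unfolding 1 using True Suc.prems assms by (intro cj_braid) auto
    also have "cj (Suc k) (tt i k) = tt i k"
      using True Suc.prems assms by (intro cj_anticommute tt_anticommute) (auto simp: e_tt)
    finally show ?thesis unfolding 1 .
  next
    case False
    then have 1: "tt i (Suc j) = cj j (tt i j)"
      using Suc.prems assms by (simp add: cj_tt_up del: tt.simps)
    have "cj k (cj j (tt i j)) = cj j (cj k (tt i j))"
      using Suc.prems assms False by (intro cj_commute) auto
    moreover have "cj k (tt i j) = tt i j"
      using Suc False by auto
    ultimately show ?thesis unfolding 1 by simp
  qed
qed simp

lemma cj_tt:
  assumes "1 \<le> i" "i < j" "j \<le> n" "1 \<le> k" "k < n"
  shows "cj k (tt i j) = t (transpose k (Suc k) i) (transpose k (Suc k) j)"
proof -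
  consider "k + 1 < i \<or> j < k" | "k + 1 = i" | "k = i" "j = Suc i" | "k = i" "Suc i < j"
    | "i < k" "Suc k < j" | "i < k" "j = Suc k" | "j = k"
    using assms by linarith
  then show ?thesis
  proof cases
    case 1
    have "cj k (tt i j) = tt i j"
      using 1 assms by (intro cj_anticommute tt_anticommute) (auto simp: e_tt)
    then show ?thesis using 1 assms by (auto simp: transpose_def t_def)
  next
    case 2
    have "cj k (tt k j) = tt i j"
      using 2 assms by (subst cj_tt_left_up) auto
    then have "cj k (tt i j) = tt k j"
      using cj_cj[of k "tt k j"] 2 assms by (simp add: e_tt)
    then show ?thesis using 2 assms by (auto simp: transpose_def t_def)
  next
    case 3
    then show ?thesis using assms by (auto simp: transpose_def t_def cj_def g_sq e_g)
  next
    case 4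
    then show ?thesis using assms by (auto simp: transpose_def t_def cj_tt_left_up simp del: tt.simps)
  next
    case 5
    then show ?thesis using assms by (auto simp: transpose_def t_def cj_tt_mid simp del: tt.simps)
  next
    case 6
    then show ?thesis using assms by (auto simp: transpose_def t_def cj_tt_down simp del: tt.simps)
  next
    case 7
    then show ?thesis using assms by (auto simp: transpose_def t_def cj_tt_up simp del: tt.simps)
  qed
qed

lemma t_swap: "i \<noteq> j \<Longrightarrow> t j i = - t i j"
  by (auto simp: t_def)

lemma e_t: "e * t i j = t i j" and t_e: "t i j * e = t i j"
  by (simp_all add: t_def e_tt e_commute[of "tt _ _"])

lemma sg_t: "sg (t i j) = - t i j"
  by (simp add: t_def sg_tt sg_minus)

lemma cj_t:
  assumes "i \<in> {1..n}" "j \<in> {1..n}" "i \<noteq> j" "1 \<le> k" "k < n"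
  shows "cj k (t i j) = t (transpose k (Suc k) i) (transpose k (Suc k) j)"
proof (cases "i < j")
  case True
  then show ?thesis using assms cj_tt[of i j k] by (simp add: t_def[of i j])
next
  case False
  have "transpose k (Suc k) i \<noteq> transpose k (Suc k) j"
    using assms(3) by (simp add: transpose_inj_iff)
  then show ?thesis
    using False assms cj_tt[of j i k] t_swap[of "transpose k (Suc k) j" "transpose k (Suc k) i"]
    by (simp add: t_def[of i j] cj_minus)
qed

text \<open>The identity \<open>(a b+1) = (b b+1)(a b)(b b+1)\<close> of permutations is lifted by
  \<open>tt a (Suc b) = cj b (tt a b)\<close>, which splits the conjugation into three whose index
  permutations compose.\<close>

lemma tt_conj:
  assumes "1 \<le> a" "a < b" "b \<le> n" "i \<in> {1..n}" "j \<in> {1..n}" "i \<noteq> j"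
  shows "- (tt a b * t i j * tt a b) = t (transpose a b i) (transpose a b j)"
  using assms(2-)
proof (induction b arbitrary: i j)
  case (Suc b)
  show ?case
  proof (cases "b = a")
    case True
    then show ?thesis using Suc.prems assms cj_t[of i j a] by (simp add: cj_def)
  next
    case False
    then have ab: "a < b" using Suc.prems by simp
    let ?s = "transpose b (Suc b)" and ?r = "transpose a b"
    have eq: "tt a (Suc b) = cj b (tt a b)"
      using assms Suc.prems ab by (simp add: cj_tt_up del: tt.simps)
    have s: "?s x \<in> {1..n}" if "x \<in> {1..n}" for x
      using that Suc.prems ab by (intro transpose_in) auto
    have r: "?r x \<in> {1..n}" if "x \<in> {1..n}" for x
      using that Suc.prems ab assms(1) by (intro transpose_in) auto
    have "- (tt a (Suc b) * t i j * tt a (Suc b)) = cj b (- (tt a b * cj b (t i j) * tt a b))"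
      unfolding eq by (simp add: cj_def mult.assoc)
    also have "cj b (t i j) = t (?s i) (?s j)"
      using Suc.prems ab by (intro cj_t) auto
    also have "- (tt a b * t (?s i) (?s j) * tt a b) = t (?r (?s i)) (?r (?s j))"
      using Suc.prems ab s by (intro Suc.IH) (auto simp: transpose_inj_iff)
    also have "cj b \<dots> = t (?s (?r (?s i))) (?s (?r (?s j)))"
      using Suc.prems ab by (intro cj_t r s) (auto simp: transpose_inj_iff)
    finally show ?thesis
      using ab by (simp add: transpose_def)
  qed
qed simp

lemma t_sq:
  assumes "a \<in> {1..n}" "b \<in> {1..n}" "a \<noteq> b"
  shows "t a b * t a b = e"
  using tt_sq_braid[of a b] tt_sq_braid[of b a] assms by (auto simp: t_def)

lemma t_conj:
  assumes "a \<in> {1..n}" "b \<in> {1..n}" "a \<noteq> b" "i \<in> {1..n}" "j \<in> {1..n}" "i \<noteq> j"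
  shows "t a b * t i j * t a b = - t (transpose a b i) (transpose a b j)"
proof (cases "a < b")
  case True
  then have 1: "t a b = tt a b" by (simp add: t_def)
  show ?thesis unfolding 1 using tt_conj[of a b i j] True assms
    by (simp only: minus_equation_iff[of "_ * _"]) simp
next
  case False
  then have 1: "t a b = - tt b a" using assms by (simp add: t_def)
  have "- (tt b a * t i j * tt b a) = t (transpose b a i) (transpose b a j)"
    using tt_conj[of b a i j] False assms by simp
  then have "tt b a * t i j * tt b a = - t (transpose a b i) (transpose a b j)"
    by (metis minus_minus transpose_commute)
  then show ?thesis unfolding 1 by simp
qed

text \<open>Together with \<open>t_sq\<close> and \<open>t_swap\<close>, this is the rewriting that
  brings words into the normal form of \<open>words_star\<close>.\<close>

lemma t_exchange:
  assumes "a \<in> {1..n}" "b \<in> {1..n}" "a \<noteq> b" "i \<in> {1..n}" "j \<in> {1..n}" "i \<noteq> j"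
  shows "t a b * t i j = - (t (transpose a b i) (transpose a b j) * t a b)"
proof -
  have "t a b * t i j = t a b * t i j * t a b * t a b"
    using assms by (simp add: mult.assoc t_sq t_e)
  then show ?thesis using t_conj[OF assms] by simp
qed

text \<open>The action of the transposition \<open>(a b)\<close>. Taking \<open>T a a\<close> to be the projection to the corner (and not
  the junk value coming from \<open>t a a\<close>) makes \<open>T_T\<close> and sums over all cosets hold uniformly.\<close>

definition T :: "nat \<Rightarrow> nat \<Rightarrow> 'a \<Rightarrow> 'a" where
  "T a b x = (if a = b then e * x else sg (t a b * x * t a b))"

lemma T_commute: "T a b x = T b a x"
  by (cases "a = b") (simp_all add: T_def t_swap[of b a])

lemma T_add: "T a b (x + y) = T a b x + T a b y"
  by (simp add: T_def distrib_left distrib_right sg_add)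

lemma T_minus: "T a b (- x) = - T a b x"
  by (simp add: T_def sg_minus)

lemma sc_left_commute: "x * (sc c * y) = sc c * (x * y)"
  by (simp add: sc_commute[of x] flip: mult.assoc)

lemma T_sc: "T a b (sc c * x) = sc c * T a b x"
  by (simp add: T_def sg_mult sg_sc sc_left_commute mult.assoc)

lemma T_0: "T a b 0 = 0"
  by (simp add: T_def sg_0)

lemma T_sum: "T a b (sum f A) = (\<Sum>i\<in>A. T a b (f i))"
  by (induction A rule: infinite_finite_induct) (simp_all add: T_0 T_add)

lemma t_e_left: "t a b * (e * x) = t a b * x"
  by (simp add: t_e flip: mult.assoc)

lemma e_t_left: "e * (t a b * x) = t a b * x"
  by (simp add: e_t flip: mult.assoc)

lemma t_sq_left:
  "a \<in> {1..n} \<Longrightarrow> b \<in> {1..n} \<Longrightarrow> a \<noteq> b \<Longrightarrow> t a b * (t a b * x) = e * x"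
  by (simp add: t_sq flip: mult.assoc)

lemma e_T: "e * T a b x = T a b x"
proof (cases "a = b")
  case False
  have "e * sg (t a b * x * t a b) = sg (e * (t a b * x * t a b))"
    by (simp only: sg_mult sg_e)
  then show ?thesis using False by (simp add: T_def mult.assoc e_t_left)
qed (simp add: T_def e_left)

lemma T_e_mult: "T a b (e * x) = T a b x"
  by (simp add: T_def mult.assoc t_e_left e_left)

lemma T_sg: "T a b (sg x) = sg (T a b x)"
  by (simp add: T_def sg_mult sg_t sg_e)

lemma T_mult:
  assumes "a \<in> {1..n}" "b \<in> {1..n}"
  shows "T a b (x * y) = T a b x * T a b y"
proof (cases "a = b")
  case True
  then show ?thesis by (metis T_def e_commute e_left mult.assoc)
next
  case False
  have "t a b * x * t a b * (t a b * y * t a b) = t a b * x * (e * (y * t a b))"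
    using assms False by (simp add: mult.assoc t_sq_left)
  also have "\<dots> = t a b * (x * y) * t a b"
    by (metis e_commute mult.assoc t_e)
  finally show ?thesis using False by (simp add: T_def flip: sg_mult)
qed

text \<open>The relation \<open>s r = (s r s^-1) s\<close> of the symmetric group. The conjugating
  element occurs on both sides of its argument, so the sign from \<open>t_conj\<close>
  cancels.\<close>

lemma T_T:
  assumes "a \<in> {1..n}" "b \<in> {1..n}" "i \<in> {1..n}" "j \<in> {1..n}"
  shows "T a b (T i j x) = T (transpose a b i) (transpose a b j) (T a b x)"
proof (cases "a = b \<or> i = j")
  case True
  have *: "T c c y = e * y" for c y by (simp add: T_def)
  from True show ?thesis
    by (elim disjE) (simp_all add: * T_e_mult e_T)
next
  case False
  have 1: "t (transpose a b i) (transpose a b j) = - (t a b * t i j * t a b)"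
    using assms False by (simp add: t_conj)
  have "t a b * t i j * t a b * (t a b * x * t a b) * (t a b * t i j * t a b)
      = t a b * (t i j * x * t i j) * t a b"
    using assms False by (simp add: mult.assoc t_sq_left t_e_left e_t_left)
  then show ?thesis
    using False by (simp add: T_def transpose_inj_iff 1 sg_mult sg_t sg_sg sg_minus)
qed

lemma T_involutory:
  assumes "a \<in> {1..n}" "b \<in> {1..n}"
  shows "T a b (T a b x) = e * x"
proof (cases "a = b")
  case False
  have "t a b * (t a b * x * t a b) * t a b = e * x"
    using assms False by (metis mult.assoc t_sq e_commute e_left)
  with False show ?thesis
    by (simp add: T_def sg_mult sg_t sg_sg)
qed (simp add: T_def e_left)

lemma T_t:
  assumes "a \<in> {1..n}" "b \<in> {1..n}" "i \<in> {1..n}" "j \<in> {1..n}" "i \<noteq> j"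
  shows "T a b (t i j) = t (transpose a b i) (transpose a b j)"
  using assms by (simp add: T_def e_t sg_mult sg_t sg_minus t_conj)

section \<open>Words in the transpositions\<close>

text \<open>Signed monomials in all the \<open>t a b\<close>, not only in the generators: exchanging
  letters relabels them and changes the sign, and both stay inside this set.\<close>

inductive_set words :: "nat set \<Rightarrow> 'a set" for S where
  unit: "e \<in> words S"
| neg: "x \<in> words S \<Longrightarrow> - x \<in> words S"
| step: "x \<in> words S \<Longrightarrow> a \<in> S \<Longrightarrow> b \<in> S \<Longrightarrow> a \<noteq> b \<Longrightarrow> t a b * x \<in> words S"

lemma words_mono: "x \<in> words S \<Longrightarrow> S \<subseteq> S' \<Longrightarrow> x \<in> words S'"
  by (induction rule: words.induct) (auto intro: words.intros)

lemma e_words: "x \<in> words S \<Longrightarrow> e * x = x"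
  by (induction rule: words.induct) (auto simp: e_e e_t_left)

lemma words_mult: "x \<in> words S \<Longrightarrow> y \<in> words S \<Longrightarrow> x * y \<in> words S"
  by (induction rule: words.induct) (auto simp: e_words mult.assoc intro: words.intros)

lemma t_in_words: "a \<in> S \<Longrightarrow> b \<in> S \<Longrightarrow> a \<noteq> b \<Longrightarrow> t a b \<in> words S"
  using words.step[OF words.unit, of a S b] by (simp add: t_e)

lemma words_parity: "x \<in> words S \<Longrightarrow> sg x = x \<or> sg x = - x"
  by (induction rule: words.induct) (auto simp: sg_e sg_mult sg_t sg_minus)

lemma T_words:
  assumes "x \<in> words S" "S \<subseteq> {1..n}" "a \<in> {1..n}" "b \<in> {1..n}"
  shows "T a b x \<in> words (transpose a b ` S)"
  using assms(1)
proof (induction rule: words.induct)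
  case unit
  have "T a b e = e"
    using assms by (auto simp: T_def e_e t_e t_sq sg_e)
  then show ?case by (simp add: words.unit)
next
  case (neg x)
  then show ?case by (simp add: T_minus words.neg)
next
  case (step x i j)
  then have "T a b (t i j * x) = t (transpose a b i) (transpose a b j) * T a b x"
    using assms by (subst T_mult) (auto simp: T_t subset_iff)
  with step show ?case
    by (auto intro!: words.step simp: transpose_inj_iff)
qed

lemma T_words_closed:
  assumes "x \<in> words S" "S \<subseteq> {1..n}" "a \<in> S" "b \<in> S"
  shows "T a b x \<in> words S"
  using T_words[OF assms(1,2), of a b] assms by (auto simp: subset_iff)

lemma T_words_fix:
  assumes "x \<in> words S" "S \<subseteq> {1..n}" "a \<in> {1..n} - S" "b \<in> {1..n} - S"
  shows "T a b x = x"
  using assms(1)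
proof (induction rule: words.induct)
  case unit
  show ?case using assms by (auto simp: T_def e_e t_e t_sq sg_e)
next
  case (neg x)
  then show ?case by (simp add: T_minus)
next
  case (step x i j)
  have "transpose a b i = i" "transpose a b j = j"
    using step assms by (auto simp: transpose_def)
  then show ?case
    using assms step by (subst T_mult) (auto simp: T_t subset_iff)
qed

text \<open>The coset decomposition of the symmetric group of \<open>insert m S\<close> modulo that of \<open>S\<close>.\<close>

lemma words_insert:
  assumes "x \<in> words (insert m S)" "insert m S \<subseteq> {1..n}" "m \<notin> S"
  shows "x \<in> words S \<or> (\<exists>j\<in>S. \<exists>u\<in>words S. x = t j m * u)"
  using assms(1)
proof (induction rule: words.induct)
  case unit
  then show ?case by (simp add: words.unit)
next
  case (neg x)
  then show ?case by (metis words.neg mult_minus_right)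
next
  case (step x a b)
  \<comment> \<open>A new letter meeting \<open>m\<close> is \<open>t a m\<close> up to sign. If the
    word already starts with \<open>t j m\<close>, the rule
    \<open>t a m * t j m = - (t j m * t a j)\<close> keeps \<open>j\<close> as the coset and pushes
    a letter without \<open>m\<close> to the right.\<close>
  have *: "t a m * x \<in> words S \<or> (\<exists>j\<in>S. \<exists>u\<in>words S. t a m * x = t j m * u)" if a: "a \<in> S" for a
    using step.IH
  proof (elim disjE bexE)
    assume "x \<in> words S"
    then show ?thesis using a by blast
  next
    fix j u assume j: "j \<in> S" and u: "u \<in> words S" and x: "x = t j m * u"
    show ?thesis
    proof (cases "a = j")
      case True
      then have "t a m * x = u"
        using assms j u unfolding x True by (subst t_sq_left) (auto simp: e_words)
      then show ?thesis using u by simp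
    next
      case False
      have "t j m * t a j = - (t a m * t j m)"
        using a j assms False by (subst t_exchange) (auto simp: transpose_def)
      then have "t a m * x = t j m * (- (t a j * u))"
        unfolding x by (simp flip: mult.assoc)
      moreover have "- (t a j * u) \<in> words S"
        using a j u False by (intro words.neg words.step)
      ultimately show ?thesis using j by blast
    qed
  qed
  consider "a \<in> S" "b \<in> S" | "a \<in> S" "b = m" | "b \<in> S" "a = m"
    using step by auto
  then show ?case
  proof cases
    case 1
    from step.IH show ?thesis
    proof (elim disjE bexE)
      assume "x \<in> words S"
      then show ?thesis using 1 step by (auto intro: words.step)
    next
      fix j u assume j: "j \<in> S" and u: "u \<in> words S" and x: "x = t j m * u"
      have "transpose a b m = m" using 1 assms by (auto simp: transpose_def)
      then have "t a b * t j m = - (t (transpose a b j) m * t a b)"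
        using 1 assms j step by (subst t_exchange) auto
      then have "t a b * x = t (transpose a b j) m * (- (t a b * u))"
        unfolding x by (simp flip: mult.assoc)
      moreover have "transpose a b j \<in> S" using 1 j by (simp add: transpose_in)
      moreover have "- (t a b * u) \<in> words S" using 1 u step by (intro words.neg words.step)
      ultimately show ?thesis by blast
    qed
  next
    case 2
    then show ?thesis using * by simp
  next
    case 3
    then have "t a b * x = - (t b m * x)" using step t_swap[of b m] by simp
    then show ?thesis
      using *[OF 3(1)] by (metis words.neg mult_minus_right)
  qed
qed

section \<open>Star normal form: leading letters that share one point\<close>

primrec star :: "nat \<Rightarrow> nat list \<Rightarrow> 'a \<Rightarrow> 'a" where
  "star m [] u = u"
| "star m (i # is) u = t i m * star m is u"

lemma star_minus: "star m is (- u) = - star m is u"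
  by (induction "is") auto

lemma star_append: "star m (is @ js) u = star m is (star m js u)"
  by (induction "is") auto

lemma T_star:
  assumes "a \<in> {1..n}" "b \<in> {1..n}" "m \<in> {1..n}" "set is \<subseteq> {1..n} - {m}"
  shows "T a b (star m is u) = star (transpose a b m) (map (transpose a b) is) (T a b u)"
  using assms(4) by (induction "is") (use assms in \<open>auto simp: T_mult T_t\<close>)

lemma words_star_closed:
  assumes "u \<in> words S" "set is \<subseteq> S" "m \<in> S" "m \<notin> set is"
  shows "star m is u \<in> words S"
  using assms(2,4) by (induction "is") (use assms in \<open>auto intro!: words.step\<close>)

text \<open>Moving \<open>t j m\<close> to the right past \<open>t i j\<close> turns this letter
  into \<open>t i m\<close> and costs a sign, so the whole star changes its center from
  \<open>j\<close> to \<open>m\<close>; \<open>v\<close> collects the signs.\<close>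

lemma star_move:
  assumes "j \<in> {1..n}" "m \<in> {1..n}" "j \<noteq> m" "set is \<subseteq> {1..n} - {j, m}"
  shows "\<exists>v\<in>{u, - u}. t j m * star j is u = star m is (t j m * v)"
  using assms(4)
proof (induction "is")
  case (Cons i "is")
  then obtain v where v: "v \<in> {u, - u}" "t j m * star j is u = star m is (t j m * v)"
    by (metis insert_subset list.simps(15))
  have "t j m * t i j = - (t i m * t j m)"
    using assms Cons by (subst t_exchange) (auto simp: transpose_def)
  then have "t j m * star j (i # is) u = star m (i # is) (t j m * - v)"
    using v(2) by (simp add: mult.assoc star_minus flip: mult.assoc[of "t j m" "t i j"])
  then show ?case using v by (intro bexI[of _ "- v"]) auto
qed auto

text \<open>Iterated coset decomposition. After \<open>x = t j m * u\<close>, the word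
  \<open>u\<close> is itself a word over \<open>S - {j}\<close> with the extra point
  \<open>j\<close>, hence a star at \<open>j\<close>; \<open>star_move\<close> recenters it at
  \<open>m\<close> with \<open>j\<close> as last index. The indices stay distinct because the star
  at \<open>j\<close> avoids \<open>j\<close>.\<close>

lemma words_star:
  assumes "finite S" "m \<notin> S" "insert m S \<subseteq> {1..n}" "x \<in> words (insert m S)"
  shows "\<exists>is u. distinct is \<and> set is \<subseteq> S \<and> u \<in> words (S - set is) \<and> x = star m is u"
  using assms
proof (induction S arbitrary: m x rule: finite_psubset_induct)
  case (psubset S)
  from words_insert[OF psubset.prems(3,2,1)] show ?case
  proof (elim disjE bexE)
    assume "x \<in> words S"
    then show ?thesis by (intro exI[of _ "[]"] exI[of _ x]) auto
  next
    fix j u assume j: "j \<in> S" and u: "u \<in> words S" and x: "x = t j m * u"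
    have "insert j (S - {j}) = S" using j by auto
    then obtain is' u' where "is'": "distinct is'" "set is' \<subseteq> S - {j}" "u' \<in> words (S - {j} - set is')" "u = star j is' u'"
      using psubset.IH[of "S - {j}" j u] psubset.prems u j by auto
    have "j \<in> {1..n}" "m \<in> {1..n}" "j \<noteq> m" "set is' \<subseteq> {1..n} - {j, m}"
      using "is'" psubset.prems j by auto
    from star_move[OF this, of u'] obtain v where v: "v \<in> {u', - u'}" "x = star m is' (t j m * v)"
      unfolding x "is'"(4) by blast
    have "S - {j} - set is' = S - set (is' @ [j])" by auto
    then have "v \<in> words (S - set (is' @ [j]))"
      using v "is'"(3) by (auto intro: words.neg)
    moreover have "x = star m (is' @ [j]) v" using v by (simp add: star_append)
    moreover have "distinct (is' @ [j])" "set (is' @ [j]) \<subseteq> S" using "is'" j by auto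
    ultimately show ?thesis by blast
  qed
qed

section \<open>Averaging\<close>

text \<open>The sum over the symmetric group on \<open>{1..m}\<close>, not divided by its order. Composing the coset sums in
  one order makes invariance of the result evident, in the other order invariance in the argument; both agree
  because each absorbs the other (\<open>E'_E\<close>).\<close>

primrec E :: "nat \<Rightarrow> 'a \<Rightarrow> 'a" where
  "E 0 x = e * x"
| "E (Suc m) x = (\<Sum>j\<in>{1..Suc m}. T j (Suc m) (E m x))"

primrec E' :: "nat \<Rightarrow> 'a \<Rightarrow> 'a" where
  "E' 0 x = e * x"
| "E' (Suc m) x = E' m (\<Sum>j\<in>{1..Suc m}. T j (Suc m) x)"

lemma E_add: "E m (x + y) = E m x + E m y"
  by (induction m) (simp_all add: distrib_left T_add sum.distrib)

lemma E_sc: "E m (sc c * x) = sc c * E m x"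
  by (induction m) (simp_all add: T_sc sum_distrib_left distrib_left sc_left_commute)

lemma E_0: "E m 0 = 0"
  using E_add[of m 0 0] by simp

lemma E_minus: "E m (- x) = - E m x"
  using E_add[of m x "- x"] by (simp add: E_0 eq_neg_iff_add_eq_0 add.commute)

lemma E_sum: "E m (sum f A) = (\<Sum>i\<in>A. E m (f i))"
  by (induction A rule: infinite_finite_induct) (simp_all add: E_0 E_add)

lemma e_E: "e * E m x = E m x"
  by (induction m) (simp_all add: e_left sum_distrib_left distrib_left e_T)

lemma E'_add: "E' m (x + y) = E' m x + E' m y"
  by (induction m arbitrary: x y) (simp_all add: distrib_left T_add sum.distrib)

lemma E'_0: "E' m 0 = 0"
  using E'_add[of m 0 0] by simp

lemma E'_sum: "E' m (sum f A) = (\<Sum>i\<in>A. E' m (f i))"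
  by (induction A rule: infinite_finite_induct) (simp_all add: E'_0 E'_add)

lemma E'_e: "E' m (e * x) = E' m x"
  by (cases m) (simp_all add: e_left T_e_mult)

lemma e_E': "e * E' m x = E' m x"
  by (induction m arbitrary: x) (simp_all add: e_left)

lemma sum_transpose:
  assumes "a \<in> A" "b \<in> A"
  shows "(\<Sum>j\<in>A. f (transpose a b j)) = sum f A"
  by (rule sum.reindex_bij_witness[of _ "transpose a b" "transpose a b"])
    (use assms in \<open>auto simp: transpose_in\<close>)

text \<open>The transposition \<open>(a b)\<close> permutes the cosets. For distinct
  \<open>a\<close>, \<open>j\<close> below \<open>b = Suc m\<close> one has
  \<open>(a b)(j b) = (j b)(a j)\<close>, and the leftover \<open>(a j)\<close> is absorbed by
  \<open>E m x\<close>, which is already invariant.\<close>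

lemma T_E:
  assumes "m \<le> n" "a \<in> {1..m}" "b \<in> {1..m}"
  shows "T a b (E m x) = E m x"
  using assms
proof (induction m arbitrary: a b)
  case (Suc m)
  let ?b = "Suc m" and ?y = "E m x"
  have *: "T a b (T j ?b ?y) = T (transpose a b j) ?b ?y" if "b \<in> {1..?b}" "a \<in> {1..m}" "j \<in> {1..?b}" for a b j
  proof (cases "b = ?b")
    case False
    then have "T a b (T j ?b ?y) = T (transpose a b j) ?b (T a b ?y)"
      using that Suc.prems by (subst T_T) auto
    then show ?thesis using Suc that False by auto
  next
    case b: True
    consider "j = a" | "j = b" | "j \<noteq> a" "j \<noteq> b" by blast
    then show ?thesis
    proof cases
      case 1
      then show ?thesis using that b Suc.prems by (auto simp: T_involutory T_def[of "Suc m" "Suc m"])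
    next
      case 2
      then show ?thesis using that b Suc.prems by (auto simp: T_def[of ?b ?b] e_E)
    next
      case 3
      have "T j b (T a j ?y) = T a b (T j b ?y)"
        using that b Suc.prems 3 by (subst T_T) auto
      moreover have "T a j ?y = ?y" using that b 3 Suc by auto
      ultimately show ?thesis using b 3 by simp
    qed
  qed
  have "T a b (E (Suc m) x) = (\<Sum>j\<in>{1..?b}. T a b (T j ?b ?y))"
    by (simp add: T_sum T_add)
  also have "\<dots> = (\<Sum>j\<in>{1..?b}. T (transpose a b j) ?b ?y)"
  proof (rule sum.cong[OF refl])
    fix j assume j: "j \<in> {1..?b}"
    consider "a \<in> {1..m}" | "b \<in> {1..m}" | "a = ?b" "b = ?b" using Suc.prems by fastforce
    then show "T a b (T j ?b ?y) = T (transpose a b j) ?b ?y"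
    proof cases
      case 1
      then show ?thesis using * j Suc.prems by blast
    next
      case 2
      then show ?thesis using *[of a b j] j Suc.prems by (simp add: T_commute[of a b] transpose_commute)
    next
      case 3
      then show ?thesis by (simp add: T_def[of ?b ?b] e_T)
    qed
  qed
  also have "\<dots> = E (Suc m) x"
    using Suc.prems sum_transpose[of a "{1..?b}" b "\<lambda>j. T j ?b ?y"] by simp
  finally show ?case .
qed simp

text \<open>Mirror image of \<open>T_E\<close>: in \<open>(j b)(a b) = (a j)(j b)\<close> the
  leftover transposition acts last and is absorbed by the outer \<open>E' m\<close>.\<close>

lemma E'_T:
  assumes "m \<le> n" "a \<in> {1..m}" "b \<in> {1..m}"
  shows "E' m (T a b x) = E' m x"
  using assms
proof (induction m arbitrary: a b x)
  case (Suc m)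
  let ?b = "Suc m"
  have *: "E' m (T j ?b (T a b x)) = E' m (T (transpose a b j) ?b x)"
    if "b \<in> {1..?b}" "a \<in> {1..m}" "j \<in> {1..?b}" for a b j
  proof (cases "b = ?b")
    case False
    have "T a b (T (transpose a b j) ?b x) = T j ?b (T a b x)"
      using that Suc.prems False transpose_in[of a "{1..n}" b j] by (subst T_T) auto
    then show ?thesis using Suc that False by (metis Suc_leD atLeastAtMost_iff le_SucE)
  next
    case b: True
    consider "j = a" | "j = b" | "j \<noteq> a" "j \<noteq> b" by blast
    then show ?thesis
    proof cases
      case 1
      then show ?thesis using that b Suc.prems by (auto simp: T_involutory T_def[of "Suc m" "Suc m"])
    next
      case 2
      then show ?thesis using that b Suc.prems by (auto simp: T_def[of ?b ?b] e_T)
    next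
      case 3
      have "T j b (T a b x) = T a j (T j b x)"
        using that b Suc.prems 3 by (subst T_T) auto
      moreover have "E' m (T a j (T j b x)) = E' m (T j b x)" using that b 3 Suc by auto
      ultimately show ?thesis using b 3 by simp
    qed
  qed
  have "E' (Suc m) (T a b x) = (\<Sum>j\<in>{1..?b}. E' m (T j ?b (T a b x)))"
    by (simp add: E'_sum E'_add)
  also have "\<dots> = (\<Sum>j\<in>{1..?b}. E' m (T (transpose a b j) ?b x))"
  proof (rule sum.cong[OF refl])
    fix j assume j: "j \<in> {1..?b}"
    consider "a \<in> {1..m}" | "b \<in> {1..m}" | "a = ?b" "b = ?b" using Suc.prems by fastforce
    then show "E' m (T j ?b (T a b x)) = E' m (T (transpose a b j) ?b x)"
    proof cases
      case 1
      then show ?thesis using * j Suc.prems by blast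
    next
      case 2
      then show ?thesis using *[of a b j] j Suc.prems by (simp add: T_commute[of a b] transpose_commute)
    next
      case 3
      then show ?thesis by (simp add: T_def[of ?b ?b] T_e_mult)
    qed
  qed
  also have "\<dots> = E' (Suc m) x"
    using Suc.prems sum_transpose[of a "{1..?b}" b "\<lambda>j. E' m (T j ?b x)"]
    by (simp add: E'_sum E'_add)
  finally show ?case .
qed simp

lemma sc_0: "sc 0 = 0"
  using sc_add[of 0 0] by simp

lemma sum_const_sc: "e * y = y \<Longrightarrow> (\<Sum>i\<in>A. y) = sc (of_nat (card A)) * y"
  by (induction A rule: infinite_finite_induct) (simp_all add: sc_0 sc_add sc_1 distrib_right)

lemma sc_cancel:
  assumes "sc c * x = sc c * y" "c \<noteq> 0"
  shows "e * x = e * y"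
proof -
  have "sc (inverse c) * (sc c * x) = sc (inverse c) * (sc c * y)" using assms by simp
  moreover have "sc (inverse c) * (sc c * z) = e * z" for z
    using assms(2) by (simp flip: mult.assoc sc_mult add: sc_1)
  ultimately show ?thesis by simp
qed

lemma E_invariant:
  assumes "\<And>a b. a \<in> {1..m} \<Longrightarrow> b \<in> {1..m} \<Longrightarrow> a \<noteq> b \<Longrightarrow> T a b x = x" "e * x = x"
  shows "E m x = sc (fact m) * x"
  using assms(1)
proof (induction m)
  case 0
  then show ?case by (simp add: sc_1)
next
  case (Suc m)
  have T: "T j (Suc m) x = x" if "j \<in> {1..Suc m}" for j
    using that Suc.prems[of j "Suc m"] assms(2) by (cases "j = Suc m") (auto simp: T_def[of "Suc m" "Suc m"])
  have "E m x = sc (fact m) * x" using Suc by simp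
  then have "E (Suc m) x = (\<Sum>j\<in>{1..Suc m}. sc (fact m) * x)"
    using T by (simp add: T_sc del: sum.cl_ivl_Suc)
  also have "\<dots> = sc (of_nat (Suc m)) * (sc (fact m) * x)"
    by (subst sum_const_sc) (auto simp: sc_left_commute[of e] assms(2))
  finally show ?case by (simp flip: mult.assoc sc_mult add: mult.commute)
qed

lemma E'_sc: "E' m (sc c * x) = sc c * E' m x"
  by (induction m arbitrary: x)
    (simp_all add: T_sc E'_sum E'_add sum_distrib_left distrib_left sc_left_commute)

lemma E'_invariant:
  assumes "\<And>a b. a \<in> {1..m} \<Longrightarrow> b \<in> {1..m} \<Longrightarrow> a \<noteq> b \<Longrightarrow> T a b x = x" "e * x = x"
  shows "E' m x = sc (fact m) * x"
  using assms(1)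
proof (induction m)
  case 0
  then show ?case using assms(2) by (simp add: sc_1)
next
  case (Suc m)
  have T: "T j (Suc m) x = x" if "j \<in> {1..Suc m}" for j
    using that Suc.prems[of j "Suc m"] assms(2) by (cases "j = Suc m") (auto simp: T_def[of "Suc m" "Suc m"])
  have "(\<Sum>j\<in>{1..Suc m}. T j (Suc m) x) = (\<Sum>j\<in>{1..Suc m}. x)"
    by (intro sum.cong refl T)
  also have "\<dots> = sc (of_nat (Suc m)) * x"
    by (subst sum_const_sc[OF assms(2)]) simp
  finally have "E' (Suc m) x = sc (of_nat (Suc m)) * E' m x"
    by (simp only: E'.simps E'_sc)
  moreover have "E' m x = sc (fact m) * x" using Suc by simp
  ultimately show ?case by (simp flip: mult.assoc sc_mult)
qed

lemma E'_E:
  assumes "m \<le> M" "M \<le> n"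
  shows "E' M (E m x) = sc (fact m) * E' M x"
  using assms(1)
proof (induction m)
  case 0
  then show ?case by (simp add: sc_1 E'_e e_E')
next
  case (Suc m)
  have "E' M (E (Suc m) x) = (\<Sum>j\<in>{1..Suc m}. E' M (T j (Suc m) (E m x)))"
    by (simp add: E'_sum E'_add)
  also have "\<dots> = (\<Sum>j\<in>{1..Suc m}. E' M (E m x))"
    using Suc.prems assms by (intro sum.cong refl E'_T) auto
  also have "\<dots> = sc (of_nat (Suc m)) * (sc (fact m) * E' M x)"
    using Suc by (subst sum_const_sc) (auto simp: e_E' sc_left_commute[of e])
  finally show ?case by (simp flip: mult.assoc sc_mult add: mult.commute)
qed

lemma E_eq_E':
  assumes "m \<le> n"
  shows "E m x = E' m x"
proof -
  have "E' m (E m x) = sc (fact m) * E m x"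
    using assms by (intro E'_invariant T_E e_E) auto
  then have "sc (fact m) * E m x = sc (fact m) * E' m x"
    using E'_E[of m m x] assms by simp
  then have "e * E m x = e * E' m x"
    by (rule sc_cancel) simp
  then show ?thesis by (simp add: e_E e_E')
qed

lemma E_T:
  assumes "m \<le> n" "a \<in> {1..m}" "b \<in> {1..m}"
  shows "E m (T a b x) = E m x"
  using E'_T[OF assms] E_eq_E'[OF assms(1)] by simp

text \<open>For \<open>S = {1..k}\<close> this becomes the image of A_k, see
  \<open>subalg_iff\<close>.\<close>

inductive_set word_span :: "nat set \<Rightarrow> 'a set" for S where
  word: "x \<in> words S \<Longrightarrow> x \<in> word_span S"
| add: "x \<in> word_span S \<Longrightarrow> y \<in> word_span S \<Longrightarrow> x + y \<in> word_span S"
| smult: "x \<in> word_span S \<Longrightarrow> sc c * x \<in> word_span S"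

lemma sc_neg: "sc (- c) = - sc c"
  using sc_add[of c "- c"] by (simp add: sc_0 eq_neg_iff_add_eq_0 add.commute)

lemma word_span_0: "0 \<in> word_span S"
  using word_span.smult[OF word_span.word[OF words.unit], of 0 S] by (simp add: sc_0)

lemma e_word_span: "x \<in> word_span S \<Longrightarrow> e * x = x"
  by (induction rule: word_span.induct) (simp_all add: e_words distrib_left sc_left_commute)

lemma word_span_minus: "x \<in> word_span S \<Longrightarrow> - x \<in> word_span S"
  using word_span.smult[of x S "- 1"] by (simp add: sc_neg sc_1 e_word_span)

lemma word_span_sum: "(\<And>i. i \<in> A \<Longrightarrow> f i \<in> word_span S) \<Longrightarrow> sum f A \<in> word_span S"
  by (induction A rule: infinite_finite_induct) (auto simp: word_span_0 intro: word_span.add)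

lemma word_span_mono: "x \<in> word_span S \<Longrightarrow> S \<subseteq> S' \<Longrightarrow> x \<in> word_span S'"
  by (induction rule: word_span.induct) (auto intro: word_span.intros words_mono)

lemma word_span_mult:
  assumes "x \<in> word_span S" "y \<in> word_span S"
  shows "x * y \<in> word_span S"
  using assms(1)
proof (induction rule: word_span.induct)
  case (word x)
  from assms(2) show ?case
    by (induction rule: word_span.induct)
      (use word in \<open>auto simp: distrib_left sc_left_commute intro: word_span.intros words_mult\<close>)
qed (auto simp: distrib_right mult.assoc intro: word_span.intros)

lemma word_span_sg: "x \<in> word_span S \<Longrightarrow> sg x \<in> word_span S"
proof (induction rule: word_span.induct)
  case (word x)
  then show ?case using words_parity[of x S] by (metis word_span.word word_span_minus)
qed (auto simp: sg_add sg_mult sg_sc intro: word_span.intros)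

lemma T_word_span:
  assumes "x \<in> word_span S" "S \<subseteq> {1..n}" "a \<in> S" "b \<in> S"
  shows "T a b x \<in> word_span S"
  using assms(1) by (induction rule: word_span.induct)
    (auto simp: T_add T_sc intro: word_span.intros T_words_closed[OF _ assms(2-)])

lemma E_word_span:
  assumes "x \<in> word_span S" "S \<subseteq> {1..n}" "{1..m} \<subseteq> S"
  shows "E m x \<in> word_span S"
  using assms(3)
proof (induction m)
  case 0
  then show ?case using assms(1) by (simp add: e_word_span)
next
  case (Suc m)
  then have "E m x \<in> word_span S" by (simp add: subset_iff)
  then have "T j (Suc m) (E m x) \<in> word_span S" if "j \<in> {1..Suc m}" for j
    using that Suc.prems assms by (intro T_word_span) auto
  then show ?case unfolding E.simps by (rule word_span_sum)
qed

section \<open>Invariants and the algebras they generate\<close>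

inductive_set Gen :: "'a set \<Rightarrow> 'a set" for X where
  base: "x \<in> X \<Longrightarrow> x \<in> Gen X"
| one: "e \<in> Gen X"
| add: "x \<in> Gen X \<Longrightarrow> y \<in> Gen X \<Longrightarrow> x + y \<in> Gen X"
| smult: "x \<in> Gen X \<Longrightarrow> sc c * x \<in> Gen X"
| mult: "x \<in> Gen X \<Longrightarrow> y \<in> Gen X \<Longrightarrow> x * y \<in> Gen X"

lemma Gen_least: "X \<subseteq> Gen Y \<Longrightarrow> Gen X \<subseteq> Gen Y"
proof
  fix x assume X: "X \<subseteq> Gen Y"
  show "x \<in> Gen X \<Longrightarrow> x \<in> Gen Y"
    by (induction rule: Gen.induct) (use X in \<open>auto intro: Gen.intros\<close>)
qed

lemma Gen_mono: "X \<subseteq> Y \<Longrightarrow> Gen X \<subseteq> Gen Y"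
  by (rule Gen_least) (auto intro: Gen.base)

lemma Gen_0: "0 \<in> Gen X"
  using Gen.smult[OF Gen.one, of 0 X] by (simp add: sc_0)

lemma Gen_sum: "(\<And>i. i \<in> A \<Longrightarrow> f i \<in> Gen X) \<Longrightarrow> sum f A \<in> Gen X"
  by (induction A rule: infinite_finite_induct) (auto simp: Gen_0 intro: Gen.add)

text \<open>The scalar -1 acts as \<open>- e\<close>, hence the factor \<open>e\<close> for elements
  that may lie outside the corner.\<close>

lemma Gen_diff:
  assumes "x \<in> Gen X" "y \<in> Gen X"
  shows "x - e * y \<in> Gen X"
  using Gen.add[OF assms(1) Gen.smult[OF assms(2), of "- 1"]] by (simp add: sc_neg sc_1)

definition Inv :: "nat \<Rightarrow> nat \<Rightarrow> 'a set" where
  "Inv k m = {x \<in> word_span {1..k}. \<forall>a\<in>{1..m}. \<forall>b\<in>{1..m}. a \<noteq> b \<longrightarrow> T a b x = x}"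

lemma e_Inv: "x \<in> Inv k m \<Longrightarrow> e * x = x"
  by (auto simp: Inv_def e_word_span)

lemma T_Inv: "x \<in> Inv k m \<Longrightarrow> a \<in> {1..m} \<Longrightarrow> b \<in> {1..m} \<Longrightarrow> T a b x = x"
  by (cases "a = b") (auto simp: Inv_def T_def[of b b] e_word_span)

lemma Inv_mono: "x \<in> Inv k m \<Longrightarrow> k \<le> k' \<Longrightarrow> m' \<le> m \<Longrightarrow> x \<in> Inv k' m'"
  unfolding Inv_def by (auto intro!: word_span_mono[of x "{Suc 0..k}"])

lemma T_e: "a \<in> {1..n} \<Longrightarrow> b \<in> {1..n} \<Longrightarrow> T a b e = e"
  by (auto simp: T_def e_e t_e t_sq sg_e)

lemma e_in_Inv: "m \<le> n \<Longrightarrow> e \<in> Inv k m"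
  unfolding Inv_def by (auto intro!: word_span.word words.unit T_e)

lemma Inv_add: "x \<in> Inv k m \<Longrightarrow> y \<in> Inv k m \<Longrightarrow> x + y \<in> Inv k m"
  by (auto simp: Inv_def T_add intro: word_span.add)

lemma Inv_smult: "x \<in> Inv k m \<Longrightarrow> sc c * x \<in> Inv k m"
  by (auto simp: Inv_def T_sc intro: word_span.smult)

lemma Inv_mult: "m \<le> n \<Longrightarrow> x \<in> Inv k m \<Longrightarrow> y \<in> Inv k m \<Longrightarrow> x * y \<in> Inv k m"
  by (auto simp: Inv_def T_mult intro: word_span_mult)

lemma Inv_sg: "x \<in> Inv k m \<Longrightarrow> sg x \<in> Inv k m"
  by (auto simp: Inv_def T_sg intro: word_span_sg)

lemma Gen_Inv:
  assumes "X \<subseteq> Inv k m" "m \<le> n"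
  shows "Gen X \<subseteq> Inv k m"
proof
  fix x show "x \<in> Gen X \<Longrightarrow> x \<in> Inv k m"
    by (induction rule: Gen.induct)
      (use assms in \<open>auto intro: e_in_Inv Inv_add Inv_smult Inv_mult\<close>)
qed

lemma E_Inv:
  assumes "x \<in> word_span {1..k}" "k \<le> n" "m \<le> k"
  shows "E m x \<in> Inv k m"
  unfolding Inv_def using assms by (auto intro!: E_word_span T_E)

text \<open>Every \<open>T\<close> occurring in the average is multiplicative and fixes
  \<open>z\<close>, so averaging is linear over the invariants.\<close>

lemma E_mult_Inv:
  assumes "z \<in> Inv k m" "m \<le> n"
  shows "E m (z * x) = z * E m x"
proof -
  have "E l (z * x) = z * E l x" if "l \<le> m" for l
    using that
  proof (induction l)
    case 0
    then show ?case by (simp add: e_commute flip: mult.assoc)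
  next
    case (Suc l)
    have "T j (Suc l) (z * E l x) = z * T j (Suc l) (E l x)" if "j \<in> {1..Suc l}" for j
      using that Suc.prems assms by (subst T_mult) (auto simp: T_Inv[OF assms(1)])
    then show ?case
      using Suc by (simp add: sum_distrib_left del: sum.cl_ivl_Suc)
  qed
  then show ?thesis by simp
qed

section \<open>Jucys-Murphy elements and the generators of the invariants\<close>

definition jm :: "nat \<Rightarrow> 'a" where "jm k = (\<Sum>i\<in>{1..<k}. t i k)"

lemma jm_in_Inv:
  assumes "Suc m \<le> n"
  shows "jm (Suc m) \<in> Inv (Suc m) m"
proof -
  have "T a b (jm (Suc m)) = jm (Suc m)" if "a \<in> {1..m}" "b \<in> {1..m}" for a b
  proof -
    have "T a b (jm (Suc m)) = (\<Sum>i\<in>{1..<Suc m}. t (transpose a b i) (transpose a b (Suc m)))"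
      unfolding jm_def T_sum using that assms by (intro sum.cong refl T_t) auto
    also have "transpose a b (Suc m) = Suc m"
      using that by (intro transpose_apply_other) auto
    finally show ?thesis
      using that by (subst (asm) sum_transpose[where f="\<lambda>i. t i (Suc m)"]) (auto simp: jm_def)
  qed
  moreover have "jm (Suc m) \<in> word_span {1..Suc m}"
    unfolding jm_def by (intro word_span_sum word_span.word t_in_words) auto
  ultimately show ?thesis by (auto simp: Inv_def)
qed

lemma sg_sum: "sg (sum f A) = (\<Sum>i\<in>A. sg (f i))"
  by (induction A rule: infinite_finite_induct) (auto simp: sg_0 sg_add)

lemma sg_jm: "sg (jm k) = - jm k"
  by (simp add: jm_def sg_sum sg_t sum_negf)

text \<open>Iterated multiplication replaces a power, as the ambient ring need not have a unit. The
  expansion runs over all index tuples, with repetitions.\<close>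

lemma jm_funpow:
  "((*) (jm k) ^^ r) u = (\<Sum>is | set is \<subseteq> {1..<k} \<and> length is = r. star k is u)"
proof (induction r)
  case 0
  have "{is. set is \<subseteq> {1..<k} \<and> length is = 0} = {[]}" by auto
  then show ?case by simp
next
  case (Suc r)
  let ?A = "\<lambda>r. {is. set is \<subseteq> {1..<k} \<and> length is = r}"
  have "((*) (jm k) ^^ Suc r) u = jm k * (\<Sum>is\<in>?A r. star k is u)"
    by (simp add: Suc)
  also have "\<dots> = (\<Sum>i\<in>{1..<k}. \<Sum>is\<in>?A r. star k (i # is) u)"
    by (simp add: jm_def sum_product)
  also have "\<dots> = (\<Sum>(i, is)\<in>{1..<k} \<times> ?A r. star k (i # is) u)"
    by (simp add: sum.cartesian_product)
  also have "\<dots> = (\<Sum>is\<in>?A (Suc r). star k is u)"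
    by (rule sum.reindex_bij_witness[of _ "\<lambda>l. (hd l, tl l)" "\<lambda>(i, l). i # l"])
      (auto simp: length_Suc_conv)
  finally show ?case .
qed

text \<open>Transitivity on tuples of distinct points, one index at a time: with \<open>ps\<close>
  the common prefix, the transposition of the next two indices extends it by one. It fixes
  \<open>ps\<close> by distinctness and \<open>u\<close> because both indices avoid
  \<open>U\<close>.\<close>

lemma E_star_eq:
  assumes "u \<in> words U" "U \<subseteq> {1..m}" "Suc m \<le> n" "length is = length js"
    and "distinct (ps @ is)" "distinct (ps @ js)"
    and "set (ps @ is) \<subseteq> {1..m} - U" "set (ps @ js) \<subseteq> {1..m} - U"
  shows "E m (star (Suc m) (ps @ is) u) = E m (star (Suc m) (ps @ js) u)"
  using assms(4-)
proof (induction r \<equiv> "length is" arbitrary: ps "is" js)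
  case (Suc r is0)
  then obtain i "is" j js' where "is": "is0 = i # is" and js: "js = j # js'"
    by (metis length_Suc_conv)
  note Cons = Suc[unfolded "is"]
  let ?s = "transpose i j"
  have ij: "i \<in> {1..m} - U" "j \<in> {1..m} - U" using Cons(3-) js by auto
  have "T i j (star (Suc m) (ps @ i # is) u)
      = star (?s (Suc m)) (map ?s (ps @ i # is)) (T i j u)"
    using Cons(3-) assms(3) ij by (intro T_star) fastforce+
  also have "?s (Suc m) = Suc m" using ij by (intro transpose_apply_other) auto
  also have "T i j u = u" using assms(1-3) ij by (intro T_words_fix) auto
  also have "map ?s (ps @ i # is) = (ps @ [j]) @ map ?s is"
    using Cons(3-) js by (auto simp: transpose_def intro!: map_idI)
  finally have "E m (star (Suc m) (ps @ i # is) u)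
      = E m (star (Suc m) ((ps @ [j]) @ map ?s is) u)"
    using E_T[of m i j "star (Suc m) (ps @ i # is) u"] ij assms(3) by simp
  also have "\<dots> = E m (star (Suc m) ((ps @ [j]) @ js') u)"
  proof (rule Suc.hyps(1))
    have "?s l \<in> {1..m} - U" if "l \<in> set is" for l
      using that Cons(3-) ij by (intro transpose_in) auto
    then show "set ((ps @ [j]) @ map ?s is) \<subseteq> {1..m} - U"
      using Cons(3-) ij by auto
    have "?s l \<notin> set ps" "j \<noteq> ?s l" if "l \<in> set is" for l
      using that Cons(3-) js by (auto simp: transpose_def)
    then show "distinct ((ps @ [j]) @ map ?s is)"
      using Cons(3-) js by (auto simp: distinct_map inj_on_def transpose_inj_iff)
  qed (use Cons(2-) js in auto)
  finally show ?case by (simp add: js "is")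
qed simp

text \<open>Expanding \<open>jm (Suc m) ^ k * E u\<close> gives \<open>E x\<close> once for every good tuple (distinct indices that avoid
  the support of \<open>u\<close>), and words of smaller support for the others.\<close>

lemma E_word_in_Gen:
  assumes "1 \<le> m" "Suc m \<le> n" "S \<subseteq> {1..m}" "x \<in> words (insert (Suc m) S)"
  shows "E m x \<in> Gen (Inv m m \<union> {jm (Suc m)})"
  using assms(3,4)
proof (induction "card S" arbitrary: S x rule: less_induct)
  case less
  let ?G = "Gen (Inv m m \<union> {jm (Suc m)})"
  have finS: "finite S" using less.prems finite_subset by blast
  obtain "is" u where "is": "distinct is" "set is \<subseteq> S" "u \<in> words (S - set is)" "x = star (Suc m) is u"
    using words_star[of S "Suc m" x] less.prems assms finS by force
  define U where "U = S - set is"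
  define A where "A = {js. set js \<subseteq> {1..<Suc m} \<and> length js = length is}"
  define B where "B = {js \<in> A. distinct js \<and> set js \<inter> U = {}}"
  have finA: "finite A" unfolding A_def by (rule finite_lists_length_eq) simp
  have BA: "B \<subseteq> A" by (auto simp: B_def)
  have "is" : "is \<in> B" "distinct is" "set is \<subseteq> S" "u \<in> words U" "x = star (Suc m) is u"
    using "is" less.prems by (auto simp: A_def B_def U_def less_Suc_eq_le)
  have U: "U \<subseteq> {1..m}" using less.prems by (auto simp: U_def)
  have "((*) (jm (Suc m)) ^^ r) (E m u) \<in> ?G" for r
  proof (induction r)
    case 0
    have "u \<in> word_span {1..m}" using words_mono[OF "is"(4) U] by (rule word_span.word)
    then show ?case using assms by (auto intro!: Gen.base E_Inv)
  next
    case (Suc r)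
    then show ?case by (auto intro!: Gen.mult Gen.base[of "jm (Suc m)"])
  qed
  moreover have "((*) (jm (Suc m)) ^^ r) (E m u) = E m (((*) (jm (Suc m)) ^^ r) u)" for r
    by (induction r) (use assms in \<open>auto simp: E_mult_Inv[OF jm_in_Inv]\<close>)
  ultimately have G: "E m (\<Sum>js\<in>A. star (Suc m) js u) \<in> ?G"
    by (simp only: A_def jm_funpow)
  have good: "E m (star (Suc m) js u) = E m x" if "js \<in> B" for js
  proof -
    have "set js \<subseteq> {1..m} - U" "set is \<subseteq> {1..m} - U"
      using that "is"(1) by (auto simp: B_def A_def less_Suc_eq_le)
    then show ?thesis
      using E_star_eq[of u U m js "is" "[]"] that "is" U assms by (auto simp: B_def A_def)
  qed
  have bad: "E m (star (Suc m) js u) \<in> ?G" if "js \<in> A - B" for js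
  proof (rule less.hyps)
    have js: "length js = length is" "set js \<subseteq> {1..m}" "\<not> distinct js \<or> set js \<inter> U \<noteq> {}"
      using that by (auto simp: A_def B_def atLeastLessThanSuc_atLeastAtMost)
    show "set js \<union> U \<subseteq> {1..m}" using js U by auto
    show "star (Suc m) js u \<in> words (insert (Suc m) (set js \<union> U))"
      using js U "is" by (intro words_star_closed) (auto intro: words_mono)
    have finU: "finite U" using U finite_subset by blast
    \<comment> \<open>The indices of \<open>is\<close> and the set \<open>U\<close> partition
      \<open>S\<close>. A bad tuple of the same length loses a point, by a repetition or by an
      overlap with \<open>U\<close>.\<close>
    have "card S = card (set is) + card U"
      using "is" finS card_mono[of S "set is"] by (simp add: U_def card_Diff_subset)
    also have "card (set is) = length js" using "is" js by (simp add: distinct_card)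
    finally have S: "card S = length js + card U" .
    show "card (set js \<union> U) < card S"
    proof (cases "distinct js")
      case True
      then have "card (set js \<inter> U) > 0" using js finU by (simp add: card_gt_0_iff)
      then show ?thesis
        using card_Un_Int[of "set js" U] finU card_length[of js] by (simp add: S)
    next
      case False
      then have "card (set js) < length js"
        using card_length[of js] card_distinct[of js] by linarith
      then show ?thesis using card_Un_le[of "set js" U] by (simp add: S)
    qed
  qed
  have "E m (\<Sum>js\<in>A. star (Suc m) js u)
      = (\<Sum>js\<in>A - B. E m (star (Suc m) js u)) + (\<Sum>js\<in>B. E m (star (Suc m) js u))"
    unfolding E_sum by (rule sum.subset_diff[OF BA finA])
  also have "(\<Sum>js\<in>B. E m (star (Suc m) js u)) = sc (of_nat (card B)) * E m x"
    using good by (simp add: sum_const_sc e_E)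
  finally have "sc (of_nat (card B)) * E m x
      = E m (\<Sum>js\<in>A. star (Suc m) js u) - (\<Sum>js\<in>A - B. E m (star (Suc m) js u))"
    by simp
  also have "\<dots> = E m (\<Sum>js\<in>A. star (Suc m) js u) - e * (\<Sum>js\<in>A - B. E m (star (Suc m) js u))"
    by (simp add: sum_distrib_left e_E)
  also have "\<dots> \<in> ?G"
    using bad by (intro Gen_diff G Gen_sum)
  finally have "sc (inverse (of_nat (card B))) * (sc (of_nat (card B)) * E m x) \<in> ?G"
    by (rule Gen.smult)
  moreover have "card B \<noteq> 0"
    using "is"(1) finite_subset[OF BA finA] by auto
  ultimately show ?case
    by (simp add: sc_1 e_E flip: mult.assoc sc_mult)
qed

lemma E_in_Gen:
  assumes "1 \<le> m" "Suc m \<le> n" "x \<in> word_span {1..Suc m}"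
  shows "E m x \<in> Gen (Inv m m \<union> {jm (Suc m)})"
  using assms(3)
proof (induction rule: word_span.induct)
  case (word x)
  have "insert (Suc m) {1..m} = {1..Suc m}" by auto
  then show ?case using word assms E_word_in_Gen[of m "{1..m}" x] by simp
qed (auto simp: E_add E_sc intro: Gen.intros)

text \<open>An invariant is its own average up to the factor \<open>m!\<close>, which is invertible
  over the complex numbers, so \<open>E_in_Gen\<close> reaches all invariants.\<close>

theorem Inv_eq_Gen:
  assumes "1 \<le> m" "Suc m \<le> n"
  shows "Inv (Suc m) m = Gen (Inv m m \<union> {jm (Suc m)})"
proof
  show "Gen (Inv m m \<union> {jm (Suc m)}) \<subseteq> Inv (Suc m) m"
    using assms by (intro Gen_Inv) (auto intro: Inv_mono jm_in_Inv)
  show "Inv (Suc m) m \<subseteq> Gen (Inv m m \<union> {jm (Suc m)})"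
  proof
    fix x assume x: "x \<in> Inv (Suc m) m"
    have "E m x = sc (fact m) * x"
      using x by (intro E_invariant T_Inv e_Inv)
    moreover have "E m x \<in> Gen (Inv m m \<union> {jm (Suc m)})"
      using x assms by (intro E_in_Gen) (auto simp: Inv_def)
    ultimately have "sc (inverse (fact m)) * (sc (fact m) * x) \<in> Gen (Inv m m \<union> {jm (Suc m)})"
      by (metis Gen.smult)
    then show "x \<in> Gen (Inv m m \<union> {jm (Suc m)})"
      using e_Inv[OF x] by (simp add: sc_1 flip: mult.assoc sc_mult)
  qed
qed

section \<open>The chain and the algebra generated by the Jucys-Murphy elements\<close>

lemma words_singleton: "x \<in> words {a} \<Longrightarrow> x = e \<or> x = - e"
  by (induction rule: words.induct) auto

lemma word_span_singleton: "x \<in> word_span {a} \<Longrightarrow> \<exists>c. x = sc c"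
proof (induction rule: word_span.induct)
  case (word x)
  then show ?case using words_singleton sc_1 sc_neg[of 1] by metis
qed (metis sc_add, metis sc_mult)

lemma sc_in_Gen: "sc c \<in> Gen X"
  using Gen.smult[OF Gen.one, of c X] sc_mult[of c 1] by (simp add: sc_1)

lemma Inv_1_in_Gen: "x \<in> Inv 1 m \<Longrightarrow> x \<in> Gen X"
  using word_span_singleton[of x 1] sc_in_Gen by (auto simp: Inv_def)

text \<open>Invariance under \<open>S_(m+1)\<close> implies invariance under \<open>S_m\<close>, so
  \<open>Inv_eq_Gen\<close> applies and each rank contributes one new generator.\<close>

lemma Inv_subset_Gen_jm:
  assumes "1 \<le> m" "m \<le> n"
  shows "Inv m m \<subseteq> Gen (jm ` {1..m})"
  using assms
proof (induction m rule: nat_induct_at_least)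
  case base
  then show ?case using Inv_1_in_Gen by auto
next
  case (Suc m)
  have "Inv (Suc m) (Suc m) \<subseteq> Gen (Inv m m \<union> {jm (Suc m)})"
    using Inv_eq_Gen[of m] Suc.hyps Suc.prems Inv_mono[of _ "Suc m" "Suc m" "Suc m" m] by auto
  also have "\<dots> \<subseteq> Gen (jm ` {1..Suc m})"
  proof (rule Gen_least)
    have "Gen (jm ` {1..m}) \<subseteq> Gen (jm ` {1..Suc m})" by (intro Gen_mono image_mono) auto
    then show "Inv m m \<union> {jm (Suc m)} \<subseteq> Gen (jm ` {1..Suc m})"
      using Suc by (auto intro: Gen.base)
  qed
  finally show ?case .
qed

lemma jm_1: "jm (Suc 0) = 0"
  by (simp add: jm_def)

theorem Gen_Inv_chain:
  "Gen (\<Union>k\<in>{1..n-1}. Inv (k + 1) k) = Gen (jm ` {1..n})"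
proof
  have "Inv (Suc k) k \<subseteq> Gen (jm ` {1..n})" if k: "k \<in> {1..n-1}" for k
  proof -
    have "Gen (Inv k k \<union> {jm (Suc k)}) \<subseteq> Gen (jm ` {1..n})"
    proof (rule Gen_least)
      have "Gen (jm ` {1..k}) \<subseteq> Gen (jm ` {1..n})" using k by (intro Gen_mono image_mono) auto
      then show "Inv k k \<union> {jm (Suc k)} \<subseteq> Gen (jm ` {1..n})"
        using order_trans[OF Inv_subset_Gen_jm[of k], of "Gen (jm ` {1..n})"] k
          Gen.base[of "jm (Suc k)" "jm ` {1..n}"] by force
    qed
    then show ?thesis using Inv_eq_Gen[of k] k by auto
  qed
  then show "Gen (\<Union>k\<in>{1..n-1}. Inv (k + 1) k) \<subseteq> Gen (jm ` {1..n})"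
    by (intro Gen_least UN_least) simp
  have "jm k \<in> Gen (\<Union>k\<in>{1..n-1}. Inv (k + 1) k)" if k: "k \<in> {1..n}" for k
  proof (cases "k = 1")
    \<comment> \<open>The chain starts with \<open>Inv 2 1\<close>; the element \<open>jm 1\<close>
      vanishes.\<close>
    case True
    then show ?thesis by (simp add: jm_1 Gen_0)
  next
    case False
    then show ?thesis
      using k jm_in_Inv[of "k - 1"] by (intro Gen.base UN_I[of "k - 1"]) auto
  qed
  then show "Gen (jm ` {1..n}) \<subseteq> Gen (\<Union>k\<in>{1..n-1}. Inv (k + 1) k)"
    by (intro Gen_least) auto
qed

text \<open>For an odd product \<open>t y\<close> with first letter \<open>t\<close>, the element
  \<open>y\<close> is even and signed conjugation by \<open>t\<close> gives \<open>- (y t)\<close>,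
  which has the same average. The letters of \<open>u\<close> thus move to the end in order, each
  with a sign, and \<open>sg u\<close> records these signs.\<close>

lemma E_rotate:
  assumes "u \<in> words {1..m}" "m \<le> n"
  shows "sg (u * x) = - (u * x) \<Longrightarrow> E m (u * x) = E m (x * sg u)"
  using assms(1)
proof (induction u arbitrary: x rule: words.induct)
  case unit
  then show ?case by (simp add: sg_e e_commute)
next
  case (neg u)
  then have "sg (u * x) = - (u * x)" by (simp add: sg_minus) (metis minus_minus)
  then show ?case using neg.IH by (simp add: sg_minus E_minus)
next
  case (step u a b)
  have ab: "a \<in> {1..n}" "b \<in> {1..n}" using step assms by auto
  have "t a b * (t a b * sg (u * x)) = t a b * (t a b * (u * x))"
    using step.prems by (simp add: sg_mult sg_t mult.assoc)
  then have "e * sg (u * x) = e * (u * x)"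
    using ab step by (simp add: t_sq_left)
  then have even: "sg (u * x) = u * x"
    using step(1) by (metis e_words mult.assoc sg_e sg_mult)
  have "T a b (t a b * u * x) = sg (e * (u * x) * t a b)"
    using ab step by (simp add: T_def mult.assoc t_sq_left)
  also have "\<dots> = - (u * x * t a b)"
    using even e_words[OF step(1)] by (simp add: sg_mult sg_t sg_e flip: mult.assoc)
  finally have "E m (t a b * u * x) = - E m (u * (x * t a b))"
    using E_T[of m a b "t a b * u * x"] step assms by (simp add: E_minus mult.assoc)
  also have "E m (u * (x * t a b)) = E m (x * t a b * sg u)"
    using even by (intro step.IH) (simp add: sg_mult sg_t mult.assoc flip: mult.assoc[of "sg u"])
  finally show ?case by (simp add: sg_mult sg_t mult.assoc E_minus)
qed

lemma sc_half: "e * x = x \<Longrightarrow> sc (1/2) * (x + x) = x"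
  using sc_add[of "1/2" "1/2"] by (simp add: distrib_left sc_1 flip: distrib_right)

text \<open>The element \<open>x - sg x\<close> is twice the odd part, a form linear in
  \<open>x\<close>; so words suffice. An odd word rotated through all of its letters returns with
  the opposite sign.\<close>

lemma E_odd_part:
  assumes "x \<in> word_span {1..m}" "m \<le> n"
  shows "E m (x - sg x) = 0"
  using assms(1)
proof (induction rule: word_span.induct)
  case (word x)
  from words_parity[OF word] show ?case
  proof
    assume "sg x = - x"
    then have "E m x = - E m x"
      using E_rotate[OF word assms(2), of e] e_words[OF word]
      by (simp add: sg_mult sg_e e_commute E_minus)
    then have "E m x + E m x = 0" by (metis add.right_inverse)
    then show ?thesis using \<open>sg x = - x\<close> by (simp add: E_add)
  qed (simp add: E_0)
next
  case (add x y)
  have "x + y - sg (x + y) = (x - sg x) + (y - sg y)" by (simp add: sg_add)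
  then show ?case using add by (simp only: E_add add_0_left)
next
  case (smult x c)
  have "sc c * x - sg (sc c * x) = sc c * (x - sg x)"
    by (simp add: sg_mult sg_sc right_diff_distrib)
  then show ?case using smult by (simp only: E_sc mult_zero_right)
qed

lemma odd_Inv_eq_0:
  assumes "x \<in> Inv m m" "m \<le> n" "sg x = - x"
  shows "x = 0"
proof -
  have "E m (x + x) = 0"
    using E_odd_part[of x m] assms by (simp add: Inv_def)
  moreover have "E m (x + x) = sc (fact m) * (x + x)"
    using Inv_add[OF assms(1,1)] by (intro E_invariant T_Inv e_Inv)
  ultimately have "e * (x + x) = e * 0"
    by (intro sc_cancel[of "fact m"]) auto
  then show ?thesis
    using sc_half[of x] e_Inv[OF assms(1)] by (simp add: distrib_left)
qed

text \<open>Invariance under \<open>(a b)\<close> multiplied by \<open>t a b\<close>: this is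
  supercommutation with \<open>t a b\<close>, with \<open>sg\<close> carrying the sign for both
  parities of \<open>z\<close>.\<close>

lemma Inv_t:
  assumes "z \<in> Inv k m" "m \<le> n" "a \<in> {1..m}" "b \<in> {1..m}" "a \<noteq> b"
  shows "z * t a b = t a b * sg z"
proof -
  have "t a b * sg z * t a b = z"
    using T_Inv[OF assms(1,3,4)] assms(5) by (simp add: T_def sg_mult sg_t)
  then have "z * t a b = t a b * sg z * t a b * t a b" by simp
  also have "\<dots> = t a b * sg z * (t a b * t a b)" by (rule mult.assoc)
  also have "\<dots> = t a b * (e * sg z)"
    using assms by (simp add: t_sq mult.assoc e_commute[of "sg z"])
  finally show ?thesis using e_Inv[OF Inv_sg[OF assms(1)]] by simp
qed

lemma even_Inv_commute:
  assumes "z \<in> Inv k m" "m \<le> n" "sg z = z" "x \<in> word_span {1..m}"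
  shows "z * x = x * z"
  using assms(4)
proof (induction rule: word_span.induct)
  case (word x)
  then show ?case
  proof (induction rule: words.induct)
    case (step x a b)
    then show ?case
      using Inv_t[OF assms(1,2), of a b] assms(3)
      by (metis mult.assoc)
  qed (auto simp: e_commute)
qed (auto simp: distrib_left distrib_right mult.assoc sc_left_commute)

lemma odd_Inv_supercommute:
  assumes "z \<in> Inv k m" "m \<le> n" "sg z = - z" "x \<in> word_span {1..m}"
  shows "z * x = sg x * z"
  using assms(4)
proof (induction rule: word_span.induct)
  case (word x)
  then show ?case
  proof (induction rule: words.induct)
    case (step x a b)
    have "z * t a b = - (t a b * z)"
      using Inv_t[OF assms(1,2), of a b] step assms(3) by simp
    then have "z * (t a b * x) = - (t a b * (z * x))"
      by (simp flip: mult.assoc)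
    then show ?case using step.IH by (simp add: sg_mult sg_t mult.assoc)
  qed (auto simp: sg_e sg_minus e_commute)
qed (auto simp: sg_add sg_mult sg_sc distrib_left distrib_right mult.assoc sc_left_commute)

text \<open>\<open>S_(m+1)\<close> is generated by \<open>S_m\<close> and \<open>(m m+1)\<close>:
  any other transposition \<open>(a m+1)\<close> is conjugate to \<open>(m m+1)\<close> by
  \<open>(a m)\<close>.\<close>

lemma T_fix_adjacent:
  assumes "\<And>a b. a \<in> {1..m} \<Longrightarrow> b \<in> {1..m} \<Longrightarrow> T a b x = x" "T m (Suc m) x = x" "Suc m \<le> n"
    "a \<in> {1..Suc m}" "b \<in> {1..Suc m}" "1 \<le> m" "e * x = x"
  shows "T a b x = x"
proof -
  have *: "T a (Suc m) x = x" if "a \<in> {1..m}" for a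
  proof (cases "a = m")
    case False
    have "T a m (T m (Suc m) x) = T (transpose a m m) (transpose a m (Suc m)) (T a m x)"
      using that assms False by (intro T_T) auto
    moreover have "T a m x = x" using assms(1)[of a m] that assms by auto
    ultimately show ?thesis using that assms False by (auto simp: transpose_def)
  qed (use assms in simp)
  consider "a = b" | "a \<in> {1..m}" "b \<in> {1..m}" | "a \<in> {1..m}" "b = Suc m" | "b \<in> {1..m}" "a = Suc m"
    using assms(4,5) by fastforce
  then show ?thesis
    using * assms(1,7) by cases (auto simp: T_def[of b b] T_commute[of "Suc m" b])
qed

text \<open>The spin form of the relation \<open>s_m L_m s_m + s_m = L_(m+1)\<close> of the
  classical Jucys-Murphy elements.\<close>

lemma T_jm:
  assumes "1 \<le> m" "Suc m \<le> n"
  shows "T m (Suc m) (jm m) + t m (Suc m) = jm (Suc m)"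
proof -
  have "T m (Suc m) (jm m) = (\<Sum>i\<in>{1..<m}. t i (Suc m))"
    unfolding jm_def T_sum
  proof (rule sum.cong[OF refl])
    fix i assume "i \<in> {1..<m}"
    then show "T m (Suc m) (t i m) = t i (Suc m)"
      using assms by (subst T_t) (auto simp: transpose_def)
  qed
  moreover have "{1..<Suc m} = insert m {1..<m}" using assms by auto
  ultimately show ?thesis by (simp add: jm_def add.commute)
qed

text \<open>A single square \<open>jm i * jm i\<close> is in general not supercentral, only the partial sums are.\<close>

lemma sum_jm_sq_in_Inv:
  assumes "m \<le> n"
  shows "(\<Sum>i\<in>{1..m}. jm i * jm i) \<in> Inv m m"
  using assms
proof (induction m rule: less_induct)
  case (less k)
  show ?case
  proof (cases k)
    case 0
    then show ?thesis by (auto simp: Inv_def word_span_0)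
  next
    case (Suc m)
    show ?thesis
    proof (cases "m = 0")
      case True
      then show ?thesis using Suc by (auto simp: Inv_def word_span_0 jm_1)
    next
      case False
      let ?S = "\<Sum>i\<in>{1..Suc m}. jm i * jm i"
      have n: "Suc m \<le> n" "1 \<le> m" using False Suc less by auto
      have inv: "?S \<in> Inv (Suc m) m"
      proof -
        have "(\<Sum>i\<in>{1..m}. jm i * jm i) \<in> Inv (Suc m) m"
        proof (rule Inv_mono)
          show "(\<Sum>i\<in>{1..m}. jm i * jm i) \<in> Inv m m"
            using less.IH[of m] Suc less.prems by simp
        qed auto
        moreover have "jm (Suc m) * jm (Suc m) \<in> Inv (Suc m) m"
          using n by (intro Inv_mult jm_in_Inv) auto
        ultimately show ?thesis by (simp add: Inv_add)
      qed
      let ?T = "T m (Suc m)" and ?A = "jm m" and ?t = "t m (Suc m)"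
      have mn: "m \<in> {1..n}" "Suc m \<in> {1..n}" using n by auto
      have T_lower: "?T (\<Sum>i\<in>{1..<m}. jm i * jm i) = (\<Sum>i\<in>{1..<m}. jm i * jm i)"
      proof -
        have "?T x = x" if "x \<in> word_span {1..<m}" for x
          using that
        proof (induction rule: word_span.induct)
          case (word x)
          then show ?case using mn by (intro T_words_fix) auto
        qed (auto simp: T_add T_sc)
        \<comment> \<open>The induction is strong because the hypothesis is used at two ranks: at
          \<open>m\<close> for invariance under \<open>S_m\<close>, and here at \<open>m - 1\<close>
          to see that these terms avoid the letters \<open>m\<close> and
          \<open>Suc m\<close>.\<close>
        moreover have "(\<Sum>i\<in>{1..<m}. jm i * jm i) \<in> word_span {1..<m}"
          using less.IH[of "m - 1"] Suc less.prems n
          by (cases m) (auto simp: Inv_def atLeastLessThanSuc_atLeastAtMost)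
        ultimately show ?thesis by blast
      qed
      define B where "B = ?T ?A"
      have eA: "e * ?A = ?A" by (simp add: jm_def sum_distrib_left e_t)
      have TB: "?T B = ?A" using mn eA by (simp add: B_def T_involutory)
      have tt: "?t * ?t = e" using mn by (intro t_sq) auto
      have "B = - (?t * ?A * ?t)" by (simp add: B_def T_def sg_mult sg_t sg_jm)
      then have Bt: "B * ?t = - (?t * ?A)" and tB: "?t * B = - (?A * ?t)"
        using tt eA by (simp_all add: mult.assoc t_e)
          (simp_all add: mult.assoc e_commute[of ?A] flip: mult.assoc[of ?t ?t] mult.assoc[of e ?A])
      have Tt: "?T ?t = - ?t"
        using mn t_swap[of m "Suc m"] by (simp add: T_t)
      have jm: "jm (Suc m) * jm (Suc m) = B * B + (B * ?t + ?t * B) + e"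
      proof -
        have "jm (Suc m) = B + ?t" using T_jm[OF n(2,1)] by (simp add: B_def)
        then show ?thesis using tt by (simp add: algebra_simps)
      qed
      \<comment> \<open>\<open>?T\<close> swaps \<open>?A\<close> with \<open>B\<close> and negates
        \<open>?t\<close>. Hence it exchanges the two squares, and the cross terms too, since
        \<open>?T (B * ?t) = - (?A * ?t) = ?t * B\<close>.\<close>
      have "?T (?A * ?A) = B * B" "?T (B * B) = ?A * ?A"
        "?T (B * ?t) = ?t * B" "?T (?t * B) = B * ?t" "?T e = e"
        using mn TB Bt tB Tt by (simp_all add: T_mult T_e T_minus flip: B_def)
      moreover have "{1..Suc m} = insert (Suc m) (insert m {1..<m})" using n by auto
      then have "?S = (\<Sum>i\<in>{1..<m}. jm i * jm i) + ?A * ?A + (B * B + (B * ?t + ?t * B) + e)"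
        by (simp add: jm algebra_simps)
      ultimately have "?T ?S = ?S"
        using T_lower by (simp add: T_add add_ac)
      then have "T a b ?S = ?S" if "a \<in> {1..Suc m}" "b \<in> {1..Suc m}" for a b
        using T_fix_adjacent[of m ?S a b] T_Inv[OF inv] e_Inv[OF inv] n that by blast
      then show ?thesis using inv Suc by (simp add: Inv_def)
    qed
  qed
qed

section \<open>Polynomials in the squares and the supercenters\<close>

abbreviation "even_jm k \<equiv> Gen ((\<lambda>i. jm i * jm i) ` {1..k})"

lemma even_jm_even: "x \<in> even_jm k \<Longrightarrow> sg x = x"
  by (induction rule: Gen.induct) (auto simp: sg_e sg_add sg_mult sg_sc sg_jm)

lemma even_jm_word_span: "x \<in> even_jm k \<Longrightarrow> x \<in> word_span {1..k}"
proof (induction rule: Gen.induct)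
  case (base x)
  have "jm i \<in> word_span {1..k}" if "i \<in> {1..k}" for i
    unfolding jm_def using that by (intro word_span_sum word_span.word t_in_words) auto
  with base show ?case by (auto intro: word_span_mult)
qed (auto intro: word_span.intros word_span_mult words.unit)

text \<open>Being odd and \<open>S_m\<close>-invariant, \<open>jm (Suc m)\<close> supercommutes with
  everything in A_m, so it commutes with the even elements \<open>jm i * jm i\<close> for
  \<open>i \<le> m\<close>; with its own square it commutes anyway.\<close>

lemma jm_even_jm_commute:
  assumes "x \<in> even_jm (Suc m)" "Suc m \<le> n"
  shows "jm (Suc m) * x = x * jm (Suc m)"
  using assms(1)
proof (induction rule: Gen.induct)
  case (base x)
  then obtain i where i: "i \<in> {1..Suc m}" "x = jm i * jm i" by auto
  show ?case
  proof (cases "i = Suc m")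
    case False
    then have "x \<in> even_jm m" using i by (auto intro!: Gen.base)
    then show ?thesis using assms even_jm_even even_jm_word_span odd_Inv_supercommute[OF jm_in_Inv, of m x]
      by (simp add: sg_jm)
  qed (simp add: i mult.assoc)
next
  case (mult x y)
  have "jm (Suc m) * (x * y) = x * (jm (Suc m) * y)"
    by (simp add: mult.IH(1) flip: mult.assoc)
  then show ?case by (simp add: mult.IH(2) mult.assoc)
qed (auto simp: e_commute distrib_left distrib_right sc_left_commute mult.assoc)

text \<open>The set of all \<open>p + jm (Suc m) * q\<close> is closed under products because
  \<open>jm (Suc m)\<close> commutes with \<open>p\<close> and \<open>q\<close> and its square
  belongs to \<open>even_jm (Suc m)\<close>. The two summands are the even and the odd part.\<close>

lemma Gen_even_jm_jm:
  assumes "x \<in> Gen (even_jm m \<union> {jm (Suc m)})" "Suc m \<le> n"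
  shows "\<exists>p\<in>even_jm (Suc m). \<exists>q\<in>even_jm (Suc m). x = p + jm (Suc m) * q"
  using assms(1)
proof (induction rule: Gen.induct)
  let ?even_jm = "even_jm (Suc m)" and ?jm = "jm (Suc m)"
  have Pe: "?jm * e = ?jm" using e_Inv[OF jm_in_Inv[OF assms(2)]] by (simp add: e_commute)
  {
    case (base x)
    have "even_jm m \<subseteq> ?even_jm" by (intro Gen_mono) auto
    then have "x = x + ?jm * 0 \<and> x \<in> ?even_jm \<or> x = 0 + ?jm * e" using base Pe by auto
    then show ?case using Gen_0 Gen.one by blast
  next
    case one
    have "e = e + ?jm * 0" by simp
    then show ?case using Gen_0 Gen.one by blast
  next
    case (add x y)
    then obtain p q p' q' where "p \<in> ?even_jm" "q \<in> ?even_jm" "p' \<in> ?even_jm" "q' \<in> ?even_jm" "x = p + ?jm * q" "y = p' + ?jm * q'"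
      by blast
    then show ?case
      by (intro bexI[of _ "p + p'"] bexI[of _ "q + q'"]) (auto simp: algebra_simps intro: Gen.add)
  next
    case (smult x c)
    then obtain p q where "p \<in> ?even_jm" "q \<in> ?even_jm" "x = p + ?jm * q"
      by blast
    then show ?case
      by (intro bexI[of _ "sc c * p"] bexI[of _ "sc c * q"])
        (auto simp: distrib_left sc_left_commute intro: Gen.smult)
  next
    case (mult x y)
    then obtain p q p' q' where pq: "p \<in> ?even_jm" "q \<in> ?even_jm" "p' \<in> ?even_jm" "q' \<in> ?even_jm" "x = p + ?jm * q" "y = p' + ?jm * q'"
      by blast
    have 1: "p * ?jm = ?jm * p" "q * ?jm = ?jm * q" using jm_even_jm_commute pq assms by auto
    have "p * (?jm * q') = ?jm * (p * q')" using 1 by (metis mult.assoc)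
    moreover have "?jm * q * (?jm * q') = ?jm * ?jm * (q * q')" using 1 by (metis mult.assoc)
    ultimately have "x * y = (p * p' + ?jm * ?jm * (q * q')) + ?jm * (p * q' + q * p')"
      unfolding pq by (simp add: distrib_left distrib_right mult.assoc add_ac)
    moreover have "p * p' + ?jm * ?jm * (q * q') \<in> ?even_jm" "p * q' + q * p' \<in> ?even_jm"
      using pq by (auto intro!: Gen.add Gen.mult Gen.base[of "?jm * ?jm"])
    ultimately show ?case by blast
  }
qed

lemma Inv_subset_even_jm:
  assumes "1 \<le> m" "m \<le> n"
  shows "Inv m m \<subseteq> even_jm m"
  using assms
proof (induction m rule: nat_induct_at_least)
  case base
  then show ?case using Inv_1_in_Gen by auto
next
  case (Suc m)
  show ?case
  proof
    fix x assume x: "x \<in> Inv (Suc m) (Suc m)"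
    then have "x \<in> Gen (Inv m m \<union> {jm (Suc m)})"
      using Inv_eq_Gen[of m] Suc.hyps Suc.prems Inv_mono[of x "Suc m" "Suc m" "Suc m" m] by auto
    also have "\<dots> \<subseteq> Gen (even_jm m \<union> {jm (Suc m)})" using Suc by (intro Gen_mono) auto
    finally obtain p q where pq: "p \<in> even_jm (Suc m)" "q \<in> even_jm (Suc m)" "x = p + jm (Suc m) * q"
      using Gen_even_jm_jm Suc.prems by blast
    let ?y = "jm (Suc m) * q"
    have odd: "sg ?y = - ?y" using pq even_jm_even by (simp add: sg_mult sg_jm)
    have "x - sg x = ?y + ?y" using pq odd even_jm_even by (simp add: sg_add)
    moreover have "e * ?y = ?y"
      using e_Inv[OF jm_in_Inv[OF Suc.prems]] by (simp flip: mult.assoc)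
    \<comment> \<open>The odd part is a combination of \<open>x\<close> and \<open>sg x\<close>, so
      it inherits the invariance of \<open>x\<close> and falls under
      \<open>odd_Inv_eq_0\<close>.\<close>
    ultimately have "?y = sc (1/2) * (x + sc (- 1) * sg x)"
      using sc_half[of ?y] e_Inv[OF Inv_sg[OF x]] by (simp add: sc_neg sc_1)
    then have "?y \<in> Inv (Suc m) (Suc m)"
      using x by (auto intro: Inv_add Inv_smult Inv_sg)
    then have "?y = 0" using odd Suc.prems by (intro odd_Inv_eq_0)
    then show "x \<in> even_jm (Suc m)" using pq by simp
  qed
qed

theorem Gen_Inv_center: "Gen (\<Union>k\<in>{1..n}. Inv k k) = Gen ((\<lambda>k. jm k * jm k) ` {1..n})"
proof
  have "Inv k k \<subseteq> even_jm n" if "k \<in> {1..n}" for k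
  proof -
    have "Inv k k \<subseteq> even_jm k" using that by (intro Inv_subset_even_jm) auto
    also have "\<dots> \<subseteq> even_jm n" using that by (intro Gen_mono image_mono) auto
    finally show ?thesis .
  qed
  then show "Gen (\<Union>k\<in>{1..n}. Inv k k) \<subseteq> even_jm n"
    by (intro Gen_least UN_least)
  let ?Z = "Gen (\<Union>k\<in>{1..n}. Inv k k)"
  have "jm k * jm k \<in> ?Z" if k: "k \<in> {1..n}" for k
  proof -
    obtain m where m: "k = Suc m" using k by (cases k) auto
    have S: "(\<Sum>i\<in>{1..l}. jm i * jm i) \<in> ?Z" if "l \<le> n" for l
      using that sum_jm_sq_in_Inv[of l] by (cases "l = 0") (auto simp: Gen_0 intro!: Gen.base UN_I[of l])
    \<comment> \<open>A difference of supercentral elements of two consecutive ranks.\<close>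
    have "jm k * jm k = (\<Sum>i\<in>{1..k}. jm i * jm i) - (\<Sum>i\<in>{1..m}. jm i * jm i)"
      by (simp add: m)
    also have "\<dots> = (\<Sum>i\<in>{1..k}. jm i * jm i) - e * (\<Sum>i\<in>{1..m}. jm i * jm i)"
      using sum_jm_sq_in_Inv[of m] k m by (simp add: e_Inv)
    also have "\<dots> \<in> ?Z" using k m by (intro Gen_diff S) auto
    finally show ?thesis .
  qed
  then show "even_jm n \<subseteq> ?Z" by (intro Gen_least) auto
qed

end

section \<open>The presented algebras as corners of a ring\<close>

lemma fa_sum: "y = (\<Sum>w\<in>Poly_Mapping.keys y. Poly_Mapping.single w (Poly_Mapping.lookup y w))"
  for y :: fa
  by (rule poly_mapping_eqI)
    (auto simp: lookup_sum lookup_single when_def in_keys_iff)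

lemma fa_induct [case_names single add]:
  fixes x :: fa
  assumes "\<And>w c. Q (Poly_Mapping.single w c)" "\<And>x y. Q x \<Longrightarrow> Q y \<Longrightarrow> Q (x + y)"
  shows "Q x"
proof -
  have "Q 0" using assms(1)[of 0 0] by simp
  then have "Q (sum f A)" if "\<And>w. Q (f w)" for f :: "wrd \<Rightarrow> fa" and A
    using that assms(2) by (induction A rule: infinite_finite_induct) auto
  from this[of "\<lambda>w. Poly_Mapping.single w (Poly_Mapping.lookup x w)" "Poly_Mapping.keys x"]
  show ?thesis using assms(1) by (simp flip: fa_sum)
qed

lemma scal_add: "scal (c + d) = scal c + scal d"
  by (simp add: scal_def single_add)

lemma scal_mult: "scal (c * d) = scal c * scal d"
  by (simp add: scal_def mult_single)

lemma scal_1: "scal 1 = 1"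
  by (simp add: scal_def)

lemma scal_commute: "x * scal c = scal c * x"
  by (induction x rule: fa_induct)
    (simp_all add: scal_def mult_single mult.commute distrib_left distrib_right)

lemma lookup_scal: "Poly_Mapping.lookup (scal c * x) w = c * Poly_Mapping.lookup x w"
  by (induction x rule: fa_induct)
    (auto simp: scal_def mult_single lookup_single when_def distrib_left lookup_add)

section \<open>The parity automorphism of the free algebra\<close>

definition par :: "fa \<Rightarrow> fa" where
  "par x = Poly_Mapping.mapp (\<lambda>w c. (- 1) ^ length (letters w) * c) x"

lemma lookup_par: "Poly_Mapping.lookup (par x) w = (- 1) ^ length (letters w) * Poly_Mapping.lookup x w"
  by (simp add: par_def lookup_mapp when_def in_keys_iff)

lemma par_single: "par (Poly_Mapping.single w c) = Poly_Mapping.single w ((- 1) ^ length (letters w) * c)"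
  by (rule poly_mapping_eqI) (auto simp: lookup_par lookup_single when_def)

lemma par_add: "par (x + y) = par x + par y"
  by (rule poly_mapping_eqI) (simp add: lookup_par lookup_add distrib_left)

lemma par_minus: "par (- x) = - par x"
  by (rule poly_mapping_eqI) (simp add: lookup_par)

lemma par_diff: "par (x - y) = par x - par y"
  using par_add[of x "- y"] by (simp add: par_minus)

lemma par_par: "par (par x) = x"
  by (rule poly_mapping_eqI) (simp add: lookup_par flip: mult.assoc power_add)

lemma letters_plus: "letters (u + v) = letters u @ letters v"
  by (cases u; cases v) simp

lemma par_mult: "par (x * y) = par x * par y"
proof (induction x rule: fa_induct)
  case (single w c)
  show ?case
    by (induction y rule: fa_induct)
      (simp_all add: mult_single par_single letters_plus power_add mult_ac distrib_left par_add)
qed (simp add: distrib_right par_add)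

lemma par_scal: "par (scal c) = scal c"
  by (simp add: scal_def par_single zero_wrd_def)

lemma par_1: "par 1 = 1"
  using par_scal[of 1] by (simp add: scal_1)

lemma par_gen: "par (gen k) = - gen k"
  by (simp add: gen_def par_single single_uminus)

lemma ideal_minus: "x \<in> ideal_n n \<Longrightarrow> - x \<in> ideal_n n"
  using ideal_n.mult[of x n "- 1" 1] by simp

text \<open>The relators are even and the extra generators odd, so \<open>par\<close> preserves the
  generators of the ideal up to sign and descends to the quotient.\<close>

lemma ideal_par: "x \<in> ideal_n n \<Longrightarrow> par x \<in> ideal_n n"
proof (induction rule: ideal_n.induct)
  case (rel r)
  then have "par r = r"
    by (auto simp: rels_def par_diff par_add par_mult par_gen par_1 power3_eq_cube power2_eq_square)
  then show ?case using rel by (simp add: ideal_n.rel)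
next
  case (extra k)
  then show ?case by (simp add: par_gen ideal_minus ideal_n.extra)
next
  case zero
  then show ?case using par_diff[of 0 0] by (simp add: ideal_n.zero)
qed (auto simp: par_add par_mult intro: ideal_n.intros)

lemma eqv_refl: "eqv n x x"
  by (simp add: eqv_def ideal_n.zero)

lemma eqv_sym: "eqv n x y \<Longrightarrow> eqv n y x"
  unfolding eqv_def using ideal_minus by fastforce

lemma eqv_trans: "eqv n x y \<Longrightarrow> eqv n y z \<Longrightarrow> eqv n x z"
  unfolding eqv_def using ideal_n.add[of "x - y" n "y - z"] by simp

lemma eqv_add: "eqv n x y \<Longrightarrow> eqv n x' y' \<Longrightarrow> eqv n (x + x') (y + y')"
  unfolding eqv_def using ideal_n.add[of "x - y" n "x' - y'"] by (simp add: algebra_simps)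

lemma eqv_minus: "eqv n x y \<Longrightarrow> eqv n (- x) (- y)"
  unfolding eqv_def using ideal_minus[of "x - y" n] by simp

lemma eqv_diff: "eqv n x y \<Longrightarrow> eqv n x' y' \<Longrightarrow> eqv n (x - x') (y - y')"
  using eqv_add[of n x y "- x'" "- y'"] by (simp add: eqv_minus)

lemma eqv_mult:
  assumes "eqv n x y" "eqv n x' y'"
  shows "eqv n (x * x') (y * y')"
proof -
  have "1 * (x - y) * x' + y * (x' - y') * 1 \<in> ideal_n n"
    using assms unfolding eqv_def by (intro ideal_n.add ideal_n.mult)
  then show ?thesis by (simp add: eqv_def algebra_simps)
qed

lemma eqv_par: "eqv n x y \<Longrightarrow> eqv n (par x) (par y)"
  unfolding eqv_def using ideal_par[of "x - y" n] by (simp add: par_diff)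

text \<open>The product of all \<open>A_n\<close>: a quotient type cannot depend on \<open>n\<close>, so \<open>cls n\<close> below embeds \<open>A_n\<close> as
  the \<open>n\<close>-th factor.\<close>

quotient_type quot_fam = "nat \<Rightarrow> fa" / "\<lambda>f h. \<forall>n. eqv n (f n) (h n)"
  by (intro equivpI reflpI sympI transpI) (auto intro: eqv_refl eqv_sym eqv_trans)

instantiation quot_fam :: ring
begin

lift_definition zero_quot_fam :: quot_fam is "\<lambda>_. 0" .
lift_definition plus_quot_fam :: "quot_fam \<Rightarrow> quot_fam \<Rightarrow> quot_fam" is "\<lambda>f h n. f n + h n" by (auto intro: eqv_add)
lift_definition uminus_quot_fam :: "quot_fam \<Rightarrow> quot_fam" is "\<lambda>f n. - f n" by (auto intro: eqv_minus)
lift_definition minus_quot_fam :: "quot_fam \<Rightarrow> quot_fam \<Rightarrow> quot_fam" is "\<lambda>f h n. f n - h n" by (auto intro: eqv_diff)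
lift_definition times_quot_fam :: "quot_fam \<Rightarrow> quot_fam \<Rightarrow> quot_fam" is "\<lambda>f h n. f n * h n" by (auto intro: eqv_mult)

instance
  by standard (transfer; simp add: algebra_simps eqv_refl)+

end

lifting_forget poly_mapping.lifting

lift_definition sgn_aut :: "quot_fam \<Rightarrow> quot_fam" is "\<lambda>f n. par (f n)" by (auto intro: eqv_par)

lift_definition cls :: "nat \<Rightarrow> fa \<Rightarrow> quot_fam" is "\<lambda>n x m. if m = n then x else 0" .

lemma cls_eq_iff: "cls n x = cls n y \<longleftrightarrow> eqv n x y"
  by transfer (auto simp: eqv_refl)

lemma cls_0: "cls n 0 = 0"
  by transfer (auto simp: eqv_refl)

lemma cls_add: "cls n (x + y) = cls n x + cls n y"
  by transfer (auto simp: eqv_refl)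

lemma cls_minus: "cls n (- x) = - cls n x"
  by transfer (auto simp: eqv_refl)

lemma cls_mult: "cls n (x * y) = cls n x * cls n y"
  by transfer (auto simp: eqv_refl)

lemma cls_sum: "cls n (sum f A) = (\<Sum>i\<in>A. cls n (f i))"
  by (induction A rule: infinite_finite_induct) (auto simp: cls_0 cls_add)

lemma par_0: "par 0 = 0"
  using par_diff[of 0 0] by simp

lemma sgn_cls: "sgn_aut (cls n x) = cls n (par x)"
  by transfer (auto simp: eqv_refl par_0)

text \<open>All ranks are interpreted at once: \<open>cls n 1\<close> is the central idempotent that
  cuts out A_n, while \<open>sgn_aut\<close> acts on the whole product and is the same map for every
  \<open>n\<close>.\<close>

interpretation A: spin_tower n "cls n 1" "\<lambda>c. cls n (scal c)" sgn_aut "\<lambda>k. cls n (gen k)" for n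
proof
  fix c d :: complex and x y :: quot_fam and k l :: nat
  show "cls n (scal (c + d)) = cls n (scal c) + cls n (scal d)" by (simp add: scal_add cls_add)
  show "cls n (scal (c * d)) = cls n (scal c) * cls n (scal d)" by (simp add: scal_mult cls_mult)
  show "cls n (scal 1) = cls n 1" by (simp add: scal_1)
  show "x * cls n (scal c) = cls n (scal c) * x"
    by transfer (auto simp: eqv_refl scal_commute)
  show "sgn_aut (x + y) = sgn_aut x + sgn_aut y" by transfer (auto simp: eqv_refl par_add)
  show "sgn_aut (x * y) = sgn_aut x * sgn_aut y" by transfer (auto simp: eqv_refl par_mult)
  show "sgn_aut (sgn_aut x) = x" by transfer (auto simp: eqv_refl par_par)
  show "sgn_aut (cls n (scal c)) = cls n (scal c)" by (simp add: sgn_cls par_scal)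
  show "sgn_aut (cls n (gen k)) = - cls n (gen k)" by (simp add: sgn_cls par_gen cls_minus)
  show "cls n 1 * cls n (gen k) = cls n (gen k)" by (simp flip: cls_mult)
  show "cls n (gen k) * cls n (gen k) = cls n 1" if "1 \<le> k" "k < n"
  proof -
    have "gen k * gen k - 1 \<in> ideal_n n"
      using that by (intro ideal_n.rel) (auto simp: rels_def)
    then show ?thesis by (simp add: cls_eq_iff eqv_def flip: cls_mult)
  qed
  show "cls n (gen k) * cls n (gen (Suc k)) * (cls n (gen k) * cls n (gen (Suc k))) *
      (cls n (gen k) * cls n (gen (Suc k))) = cls n 1" if "1 \<le> k" "Suc k < n"
  proof -
    have "(gen k * gen (k + 1)) ^ 3 - 1 \<in> ideal_n n"
      using that by (intro ideal_n.rel) (auto simp: rels_def)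
    then show ?thesis
      by (simp add: cls_eq_iff eqv_def power3_eq_cube flip: cls_mult)
  qed
  show "cls n (gen k) * cls n (gen l) * (cls n (gen k) * cls n (gen l)) = - cls n 1"
    if "1 \<le> k" "k < n" "1 \<le> l" "l < n" "k > l + 1 \<or> l > k + 1"
  proof -
    have "(gen k * gen l) ^ 2 + 1 \<in> rels n"
      unfolding rels_def using that by (intro UnI2 CollectI exI[of _ k] exI[of _ l]) auto
    \<comment> \<open>Written as a difference to match \<open>eqv\<close> with right-hand side
      \<open>- 1\<close>.\<close>
    then have "(gen k * gen l) ^ 2 - - 1 \<in> ideal_n n"
      using ideal_n.rel by simp
    then show ?thesis
      by (simp only: cls_eq_iff eqv_def power2_eq_square flip: cls_mult cls_minus)
  qed
qed

lemma cls_tauij: "cls n (tauij i j) = A.tt n i j"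
  by (induction j) (auto simp: cls_0 cls_minus cls_mult)

lemma cls_pi_el: "cls n (pi_el k) = A.jm n k"
  by (auto simp: pi_el_def A.jm_def cls_sum cls_tauij A.t_def intro!: sum.cong)

section \<open>The subalgebras A_k as spans of words in transpositions\<close>

definition on_letters :: "nat \<Rightarrow> fa set" where
  "on_letters k = {y. \<forall>w\<in>Poly_Mapping.keys y. \<forall>j\<in>set (letters w). 1 \<le> j \<and> j < k}"

lemma subalg_cls: "x \<in> subalg n k \<longleftrightarrow> (\<exists>y\<in>on_letters k. cls n x = cls n y)"
  by (auto simp: subalg_def on_letters_def cls_eq_iff)

lemma on_letters_add: "x \<in> on_letters k \<Longrightarrow> y \<in> on_letters k \<Longrightarrow> x + y \<in> on_letters k"
  using keys_add[of x y] by (auto simp: on_letters_def)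

lemma on_letters_mult: "x \<in> on_letters k \<Longrightarrow> y \<in> on_letters k \<Longrightarrow> x * y \<in> on_letters k"
  using keys_mult[of x y] by (force simp: on_letters_def letters_plus)

lemma on_letters_scal: "scal c \<in> on_letters k"
  by (auto simp: on_letters_def scal_def zero_wrd_def)

lemma on_letters_0: "0 \<in> on_letters k"
  by (simp add: on_letters_def)

lemma on_letters_gen: "1 \<le> j \<Longrightarrow> j < k \<Longrightarrow> gen j \<in> on_letters k"
  by (auto simp: on_letters_def gen_def)

lemma on_letters_minus: "x \<in> on_letters k \<Longrightarrow> - x \<in> on_letters k"
  by (auto simp: on_letters_def in_keys_iff)

lemma tauij_on_letters: "1 \<le> i \<Longrightarrow> j \<le> k \<Longrightarrow> tauij i j \<in> on_letters k"
  by (induction j)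
    (auto intro!: on_letters_minus on_letters_mult on_letters_gen on_letters_0)

lemma word_span_on_letters:
  assumes "z \<in> A.word_span n {1..k}"
  shows "\<exists>y\<in>on_letters k. z = cls n y"
  using assms
proof (induction rule: A.word_span.induct)
  case (word x)
  then show ?case
  proof (induction rule: A.words.induct)
    case unit
    show ?case using on_letters_scal[of 1 k] by (auto simp: scal_1)
  next
    case (neg x)
    then show ?case by (metis on_letters_minus cls_minus)
  next
    case (step x a b)
    have "A.t n a b = cls n (if a < b then tauij a b else - tauij b a)"
      by (simp add: A.t_def cls_tauij cls_minus)
    moreover have "(if a < b then tauij a b else - tauij b a) \<in> on_letters k"
      using step by (auto intro!: on_letters_minus tauij_on_letters)
    moreover obtain y where "y \<in> on_letters k" "x = cls n y" using step.IH by blast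
    ultimately show ?case
      by (intro bexI[of _ "(if a < b then tauij a b else - tauij b a) * y"] on_letters_mult)
        (simp_all only: cls_mult)
  qed
next
  case (add x y)
  then show ?case by (metis on_letters_add cls_add)
next
  case (smult x c)
  then show ?case by (metis on_letters_mult on_letters_scal cls_mult)
qed

lemma cls_word_word_span:
  assumes "\<forall>j\<in>set xs. 1 \<le> j \<and> j < k"
  shows "cls n (Poly_Mapping.single (Wd xs) c) \<in> A.word_span n {1..k}"
  using assms
proof (induction xs)
  case Nil
  have "cls n (scal c) * cls n 1 \<in> A.word_span n {1..k}"
    by (intro A.word_span.smult A.word_span.word A.words.unit)
  then show ?case by (simp add: scal_def zero_wrd_def flip: cls_mult)
next
  case (Cons j xs)
  have "Poly_Mapping.single (Wd (j # xs)) c = gen j * Poly_Mapping.single (Wd xs) c"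
    by (simp add: gen_def mult_single)
  moreover have "cls n (gen j) = A.t n j (Suc j)" by (simp add: A.t_def)
  moreover have "A.t n j (Suc j) \<in> A.word_span n {1..k}"
    using Cons by (intro A.word_span.word A.t_in_words) auto
  ultimately show ?case using Cons by (simp add: cls_mult A.word_span_mult)
qed

lemma on_letters_word_span:
  assumes "y \<in> on_letters k"
  shows "cls n y \<in> A.word_span n {1..k}"
proof -
  have "cls n (Poly_Mapping.single w (Poly_Mapping.lookup y w)) \<in> A.word_span n {1..k}"
    if "w \<in> Poly_Mapping.keys y" for w
    using that assms cls_word_word_span[of "letters w" k n] by (cases w) (auto simp: on_letters_def)
  then show ?thesis
    by (subst fa_sum) (auto simp: cls_sum intro: A.word_span_sum)
qed

text \<open>Each generator \<open>gen j\<close> is the transposition element of \<open>j\<close> and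
  \<open>j + 1\<close>, and each \<open>tauij i j\<close> with \<open>j \<le> k\<close> is a word,
  up to sign, in generators below \<open>k\<close>; so both kinds of words span the same
  space.\<close>

lemma subalg_iff: "x \<in> subalg n k \<longleftrightarrow> cls n x \<in> A.word_span n {1..k}"
  unfolding subalg_cls using word_span_on_letters on_letters_word_span by metis

section \<open>Homogeneous elements as eigenvectors of the parity automorphism\<close>

lemma parity_keys:
  assumes "\<forall>w\<in>Poly_Mapping.keys y. length (letters w) mod 2 = p"
  shows "par y = scal ((- 1) ^ p) * y"
proof (rule poly_mapping_eqI)
  fix w
  show "Poly_Mapping.lookup (par y) w = Poly_Mapping.lookup (scal ((- 1) ^ p) * y) w"
  proof (cases "w \<in> Poly_Mapping.keys y")
    case True
    then have "(- 1 :: complex) ^ length (letters w) = (- 1) ^ p"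
      using assms by (metis minus_one_power_iff even_mod_2_iff)
    then show ?thesis by (simp add: lookup_par lookup_scal)
  qed (simp add: lookup_par lookup_scal in_keys_iff)
qed

text \<open>Given an eigenvector class, the projection \<open>(x + (-1)^p par x) / 2\<close> of any
  representative is another representative, and its words all have parity \<open>p\<close>.\<close>

lemma homog_iff: "homog n p x \<longleftrightarrow> p < 2 \<and> sgn_aut (cls n x) = cls n (scal ((- 1) ^ p)) * cls n x"
proof (intro iffI conjI; (elim conjE)?)
  assume "homog n p x"
  then obtain y where y: "p < 2" "cls n x = cls n y" "\<forall>w\<in>Poly_Mapping.keys y. length (letters w) mod 2 = p"
    unfolding homog_def cls_eq_iff by blast
  show "p < 2" by (rule y)
  show "sgn_aut (cls n x) = cls n (scal ((- 1) ^ p)) * cls n x"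
    using parity_keys[OF y(3)] by (simp add: y(2) sgn_cls flip: cls_mult)
next
  assume p: "p < 2" and sg: "sgn_aut (cls n x) = cls n (scal ((- 1) ^ p)) * cls n x"
  define y where "y = scal (1 / 2) * (x + scal ((- 1) ^ p) * par x)"
  have ee: "((- 1) ^ p * (- 1) ^ p :: complex) = 1" by (simp flip: power_add)
  have "cls n (scal ((- 1) ^ p)) * cls n (par x) = cls n (scal ((- 1) ^ p * (- 1) ^ p) * x)"
    using sg by (simp only: sgn_cls scal_mult cls_mult mult.assoc)
  then have "cls n y = cls n (scal (1 / 2)) * (cls n x + cls n x)"
    unfolding ee by (simp add: y_def cls_mult cls_add scal_1)
  also have "\<dots> = cls n x"
    by (rule A.sc_half) (simp flip: cls_mult)
  finally have "eqv n x y" by (simp flip: cls_eq_iff)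
  moreover have "length (letters w) mod 2 = p" if "w \<in> Poly_Mapping.keys y" for w
  proof (rule ccontr)
    assume "length (letters w) mod 2 \<noteq> p"
    then have "(- 1) ^ p * (- 1) ^ length (letters w) = (- 1 :: complex)"
      using p by (auto simp: less_2_cases_iff minus_one_power_iff even_iff_mod_2_eq_zero)
    then have "Poly_Mapping.lookup y w = 0"
      by (simp add: y_def lookup_scal lookup_add lookup_par flip: mult.assoc)
    then show False using that by (simp add: in_keys_iff)
  qed
  ultimately show "homog n p x" using p by (auto simp: homog_def)
qed

lemma e_cls: "cls n 1 * cls n x = cls n x"
  by (simp flip: cls_mult)

lemma e_cls_left: "cls n 1 * (cls n x * y) = cls n x * y"
  by (simp add: e_cls flip: mult.assoc)

lemma homog_0_iff: "homog n 0 x \<longleftrightarrow> sgn_aut (cls n x) = cls n x"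
  by (simp add: homog_iff scal_1 e_cls)

lemma scal_uminus: "scal (- c) = - scal c"
  by (simp add: scal_def single_uminus)

lemma homog_1_iff: "homog n (Suc 0) x \<longleftrightarrow> sgn_aut (cls n x) = - cls n x"
  by (simp add: homog_iff scal_1 scal_uminus cls_minus e_cls)

section \<open>Supercentralizers as invariants\<close>

definition SZ_hom :: "nat \<Rightarrow> nat \<Rightarrow> nat \<Rightarrow> fa set" where
  "SZ_hom n k m = {a. a \<in> subalg n k \<and> (\<exists>p. homog n p a \<and>
        (\<forall>b q. b \<in> subalg n m \<and> homog n q b \<longrightarrow> eqv n (a * b) ((-1) ^ (p * q) * (b * a))))}"

text \<open>It suffices to test against \<open>b = tauij i j\<close>, which is odd: then
  \<open>t a t = (-1)^p a\<close>, and the parity automorphism multiplies by \<open>(-1)^p\<close>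
  once more, so \<open>T\<close> fixes \<open>a\<close> for either \<open>p\<close>.\<close>

lemma SZ_hom_imp_Inv:
  assumes "a \<in> SZ_hom n k m" "m \<le> n"
  shows "cls n a \<in> A.Inv n k m"
proof -
  obtain p where p: "homog n p a"
    and comm: "\<And>b q. b \<in> subalg n m \<Longrightarrow> homog n q b \<Longrightarrow> eqv n (a * b) ((-1) ^ (p * q) * (b * a))"
    using assms by (auto simp: SZ_hom_def)
  have "A.T n i j (cls n a) = cls n a" if ij: "i \<in> {1..m}" "j \<in> {1..m}" "i < j" for i j
  proof -
    have t: "cls n (tauij i j) = A.t n i j" using ij by (simp add: cls_tauij A.t_def)
    have "tauij i j \<in> subalg n m" "homog n (Suc 0) (tauij i j)"
      using ij by (auto simp: subalg_iff homog_1_iff t A.sg_t intro!: A.word_span.word A.t_in_words)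
    from comm[OF this] have c: "cls n a * A.t n i j = cls n ((-1) ^ p * (tauij i j * a))"
      by (simp add: cls_mult t flip: cls_eq_iff)
    have tt: "A.t n i j * (A.t n i j * z) = cls n 1 * z" for z
      using ij assms by (intro A.t_sq_left) auto
    from p have "p = 0 \<or> p = 1" by (auto simp: homog_def)
    then show ?thesis
    proof
      assume "p = 0"
      then have "A.t n i j * cls n a * A.t n i j = cls n a" "sgn_aut (cls n a) = cls n a"
        using c tt[of "cls n a"] p by (simp_all add: cls_mult t mult.assoc e_cls homog_0_iff)
      then show ?thesis using ij by (simp add: A.T_def)
    next
      assume "p = 1"
      then have "A.t n i j * cls n a * A.t n i j = - cls n a" "sgn_aut (cls n a) = - cls n a"
        using c tt[of "cls n a"] p by (simp_all add: cls_mult cls_minus t mult.assoc e_cls homog_1_iff)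
      then show ?thesis using ij by (simp add: A.T_def A.sg_minus)
    qed
  qed
  moreover have "cls n a \<in> A.word_span n {1..k}"
    using assms by (simp add: SZ_hom_def subalg_iff)
  ultimately show ?thesis
    unfolding A.Inv_def by (auto simp: linorder_neq_iff) (metis A.T_commute)+
qed

lemma even_Inv_imp_SZ_hom:
  assumes "cls n a \<in> A.Inv n k m" "m \<le> n" "sgn_aut (cls n a) = cls n a"
  shows "a \<in> SZ_hom n k m"
  unfolding SZ_hom_def
proof (intro CollectI conjI exI[of _ 0] allI impI)
  show "a \<in> subalg n k" using assms by (simp add: A.Inv_def subalg_iff)
  show "homog n 0 a" using assms by (simp add: homog_0_iff)
  fix b r assume "b \<in> subalg n m \<and> homog n r b"
  then show "eqv n (a * b) ((- 1) ^ (0 * r) * (b * a))"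
    using A.even_Inv_commute[OF assms, of "cls n b"] by (simp add: subalg_iff cls_mult flip: cls_eq_iff)
qed

lemma odd_Inv_imp_SZ_hom:
  assumes "cls n a \<in> A.Inv n k m" "m \<le> n" "sgn_aut (cls n a) = - cls n a"
  shows "a \<in> SZ_hom n k m"
  unfolding SZ_hom_def
proof (intro CollectI conjI exI[of _ 1] allI impI)
  show "a \<in> subalg n k" using assms by (simp add: A.Inv_def subalg_iff)
  show "homog n 1 a" using assms by (simp add: homog_1_iff)
  fix b r assume b: "b \<in> subalg n m \<and> homog n r b"
  then have *: "cls n a * cls n b = sgn_aut (cls n b) * cls n a"
    by (intro A.odd_Inv_supercommute[OF assms]) (simp add: subalg_iff)
  from b have "r = 0 \<or> r = 1" by (auto simp: homog_def)
  then show "eqv n (a * b) ((- 1) ^ (1 * r) * (b * a))"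
    using * b by (auto simp: homog_0_iff homog_1_iff cls_mult cls_minus e_cls_left simp flip: cls_eq_iff)
qed

text \<open>The invariants are stable under the parity automorphism, hence contain the even and odd
  parts of their elements; these parts are the homogeneous elements that span
  \<open>SZ\<close>.\<close>

lemma SZ_iff:
  assumes "m \<le> n"
  shows "x \<in> SZ n k m \<longleftrightarrow> cls n x \<in> A.Inv n k m"
proof
  have SZ: "SZ n k m = qspan n (SZ_hom n k m)" by (simp add: SZ_def SZ_hom_def)
  {
    assume "x \<in> SZ n k m"
    then show "cls n x \<in> A.Inv n k m"
      unfolding SZ
    proof (induction rule: qspan.induct)
      case (base x)
      then show ?case using assms by (rule SZ_hom_imp_Inv)
    next
      case zero
      have "cls n (scal 0) * cls n 1 \<in> A.Inv n k m"
        using assms by (intro A.Inv_smult A.e_in_Inv)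
      then show ?case by (simp add: scal_def cls_0)
    next
      case (add x y)
      then show ?case by (simp add: cls_add A.Inv_add)
    next
      case (smult x c)
      then show ?case by (simp add: cls_mult A.Inv_smult)
    next
      case (eq x y)
      then show ?case by (simp flip: cls_eq_iff)
    qed
  }
  {
    assume x: "cls n x \<in> A.Inv n k m"
    let ?x0 = "x + par x" and ?x1 = "x + scal (- 1) * par x"
    have par: "cls n (par x) \<in> A.Inv n k m" using A.Inv_sg[OF x] by (simp add: sgn_cls)
    have "?x0 \<in> SZ_hom n k m"
    proof (intro even_Inv_imp_SZ_hom assms)
      show "cls n ?x0 \<in> A.Inv n k m" using x par by (simp add: cls_add A.Inv_add)
      show "sgn_aut (cls n ?x0) = cls n ?x0" by (simp add: sgn_cls par_add par_par add.commute)
    qed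
    moreover have "?x1 \<in> SZ_hom n k m"
    proof (intro odd_Inv_imp_SZ_hom assms)
      show "cls n ?x1 \<in> A.Inv n k m"
        using x par by (simp add: cls_add cls_mult A.Inv_add A.Inv_smult)
      show "sgn_aut (cls n ?x1) = - cls n ?x1"
        by (simp add: sgn_cls par_add par_par scal_uminus scal_1 par_minus par_diff flip: cls_minus)
    qed
    ultimately have "scal (1 / 2) * (?x0 + ?x1) \<in> SZ n k m"
      unfolding SZ by (intro qspan.smult qspan.add qspan.base)
    moreover have "cls n (scal (1 / 2) * (?x0 + ?x1)) = cls n x"
      using A.sc_half[of n "cls n x"] by (simp add: cls_mult cls_add scal_uminus scal_1 cls_minus e_cls)
    ultimately show "x \<in> SZ n k m"
      unfolding SZ by (metis qspan.eq cls_eq_iff)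
  }
qed

lemma cls_image_SZ:
  assumes "m \<le> n"
  shows "cls n ` SZ n k m = A.Inv n k m"
proof
  show "cls n ` SZ n k m \<subseteq> A.Inv n k m" using SZ_iff[OF assms] by blast
  show "A.Inv n k m \<subseteq> cls n ` SZ n k m"
  proof
    fix z assume z: "z \<in> A.Inv n k m"
    then obtain y where "z = cls n y"
      using word_span_on_letters[of z n k] by (auto simp: A.Inv_def)
    then show "z \<in> cls n ` SZ n k m" using z SZ_iff[OF assms] by blast
  qed
qed

lemma qgen_iff: "x \<in> qgen n S \<longleftrightarrow> cls n x \<in> A.Gen n (cls n ` S)"
proof
  assume "x \<in> qgen n S"
  then show "cls n x \<in> A.Gen n (cls n ` S)"
  proof (induction rule: qgen.induct)
    case (eq x y)
    then show ?case by (simp flip: cls_eq_iff)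
  qed (auto simp: cls_add cls_mult intro: A.Gen.intros)
next
  have "\<exists>y\<in>qgen n S. z = cls n y" if "z \<in> A.Gen n (cls n ` S)" for z
    using that
  proof (induction rule: A.Gen.induct)
    case (add x y)
    then show ?case by (metis qgen.add cls_add)
  next
    case (smult x c)
    then show ?case by (metis qgen.smult cls_mult)
  next
    case (mult x y)
    then show ?case by (metis qgen.mult cls_mult)
  qed (auto intro: qgen.intros)
  then show "x \<in> qgen n S" if "cls n x \<in> A.Gen n (cls n ` S)"
    using that by (metis qgen.eq cls_eq_iff)
qed

lemma qgen_eqI:
  "A.Gen n (cls n ` S) = A.Gen n (cls n ` S') \<Longrightarrow> qgen n S = qgen n S'"
  by (auto simp: qgen_iff)

theorem mainTheorem16:
  shows "(\<forall>n::nat. n \<ge> 2 \<longrightarrow>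
            SZ n n (n - 1) = qgen n (SZ n (n - 1) (n - 1) \<union> {pi_el n}))
       \<and> (\<forall>n::nat. n \<ge> 1 \<longrightarrow>
            qgen n (\<Union>k\<in>{1..n-1}. SZ n (k + 1) k) = qgen n (pi_el ` {1..n}))
       \<and> (\<forall>n::nat. n \<ge> 1 \<longrightarrow>
            qgen n (\<Union>k\<in>{1..n}. SZ n k k) = qgen n ((\<lambda>k. pi_el k ^ 2) ` {1..n}))"
proof (intro conjI allI impI)
  fix n :: nat assume "n \<ge> 2"
  then obtain m where m: "n = Suc m" "1 \<le> m" by (cases n) auto
  show "SZ n n (n - 1) = qgen n (SZ n (n - 1) (n - 1) \<union> {pi_el n})"
  proof (rule set_eqI)
    fix x
    have "cls n ` (SZ n m m \<union> {pi_el n}) = A.Inv n m m \<union> {A.jm n n}"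
      using cls_image_SZ[of m n m] m by (simp add: image_Un cls_pi_el)
    then show "x \<in> SZ n n (n - 1) \<longleftrightarrow> x \<in> qgen n (SZ n (n - 1) (n - 1) \<union> {pi_el n})"
      using SZ_iff[of m n x n] A.Inv_eq_Gen[of m n] m by (simp add: qgen_iff)
  qed
next
  fix n :: nat assume "n \<ge> 1"
  have "cls n ` (\<Union>k\<in>{1..n-1}. SZ n (k + 1) k) = (\<Union>k\<in>{1..n-1}. A.Inv n (k + 1) k)"
    unfolding image_UN by (intro SUP_cong refl cls_image_SZ) auto
  then show "qgen n (\<Union>k\<in>{1..n-1}. SZ n (k + 1) k) = qgen n (pi_el ` {1..n})"
    using A.Gen_Inv_chain[of n] by (intro qgen_eqI) (simp only: image_image cls_pi_el)
next
  fix n :: nat assume "n \<ge> 1"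
  have "cls n ` (\<Union>k\<in>{1..n}. SZ n k k) = (\<Union>k\<in>{1..n}. A.Inv n k k)"
    unfolding image_UN by (intro SUP_cong refl cls_image_SZ) auto
  then show "qgen n (\<Union>k\<in>{1..n}. SZ n k k) = qgen n ((\<lambda>k. pi_el k ^ 2) ` {1..n})"
    using A.Gen_Inv_center[of n]
    by (intro qgen_eqI) (simp only: image_image cls_pi_el power2_eq_square cls_mult)
qed

end
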